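(* Let $a>0$, $x>0$, $0<\theta,\psi<1$, let $k\geq 1$ be an odd integer, and let $\nu\in\mathbb{C}$ with $\Re(\nu)>0$. Then \begin{align*} &\left(\frac{a^2x}{4}\right)^{\frac{\nu}{2}+k+1}\sum_{n=1}^{\infty} n^{\nu/2}K_{\nu}(a\sqrt{nx})\sum_{d\mid n}d^k\sin(2\pi d\theta)\sin\left(\frac{2\pi n\psi}{d}\right)\\ &=-\frac{(-1)^{\frac{k+1}{2}}}{8(2\pi)^{-k-1}}\Gamma(\nu+k+1)\sum_{m,n\geq 0}\left\{\frac{(n+\psi)^k}{\left(\frac{16\pi^2}{a^2}\frac{(n+\psi)(m+\theta)}{x}+1\right)^{\nu+k+1}}-\frac{(n+1-\psi)^k}{\left(\frac{16\pi^2}{a^2}\frac{(n+1-\psi)(m+\theta)}{x}+1\right)^{\nu+k+1}}\right.\\ &\qquad\left.-\frac{(n+\psi)^k}{\left(\frac{16\pi^2}{a^2}\frac{(n+\psi)(m+1-\theta)}{x}+1\right)^{\nu+k+1}}+\frac{(n+1-\psi)^k}{\left(\frac{16\pi^2}{a^2}\frac{(n+1-\psi)(m+1-\theta)}{x}+1\right)^{\nu+k+1}}\right\}. \end{align*}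
   Context: $K_\nu$ denotes the modified Bessel function of the second kind of order $\nu$. The double sum runs over all pairs of non-negative integers $m,n$. *)

theory Defs
  imports "HOL-Analysis.Analysis"
begin

text \<open>Modified Bessel function of the second kind, for real argument z > 0 and
complex order nu, via the standard integral representation
K_nu(z) = int_0^infty exp(-z cosh t) cosh(nu t) dt.\<close>
definition besselK :: "complex \<Rightarrow> real \<Rightarrow> complex" where
  "besselK \<nu> z = integral {0..} (\<lambda>t::real. complex_of_real (exp (- z * cosh t)) * cosh (\<nu> * complex_of_real t))"

end

theory Submission
  imports Defs
begin

text \<open>
  Put \<open>q = a\<^sup>2 * x / 4\<close> and let \<open>F y\<close> be the sum of
  \<open>d ^ k * sin (2 * pi * d * \<theta>) * sin (2 * pi * e * \<psi>) * exp (- y * d * e)\<close> over \<open>d, e \<ge> 1\<close>.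
  Since \<open>2 * w powr (\<nu> / 2) * K\<^sub>\<nu>(2 * sqrt w)\<close> is the integral of
  \<open>t powr (\<nu> - 1) * exp (- t - w / t)\<close> over \<open>t > 0\<close>, the Bessel series is a Mellin type integral of
  \<open>F (q / t)\<close>. Likewise the Gamma integral turns the double series on the right into an integral of
  \<open>G Y\<close>, the signed sum of \<open>u ^ k * exp (- Y * u * v)\<close> over
  \<open>u \<in> {n + \<psi>, n + 1 - \<psi>}\<close> and \<open>v \<in> {m + \<theta>, m + 1 - \<theta>}\<close>. The theorem is therefore the modular
  relation between \<open>F y\<close> and \<open>G (4 * pi\<^sup>2 / y)\<close>, a transformation of Eisenstein series of weight
  \<open>k + 1\<close>. It follows from Poisson summation in \<open>u\<close> and then Lipschitz summation in \<open>v\<close>.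
  The lattice sum in between converges only conditionally when \<open>k = 1\<close>. Applying Poisson
  summation to the function of \<open>u\<close> already summed over \<open>v\<close> avoids any rearrangement of it.
\<close>

section \<open>Pointwise convergence of Fourier series\<close>

text \<open>The case \<open>k = 1\<close> shapes the analysis. Summed over \<open>v\<close>, the
  function of \<open>u\<close> is u^k e^(-Y \<alpha> u) / (1 - e^(-Y u)) for u > 0, which for
  \<open>k = 1\<close> tends to 1/Y at 0 from the right but has value 0 at 0. Its periodization
  jumps at the integers, so its Fourier coefficients decay only like 1/n. What is needed is a
  convergence theorem that asks for regularity at one point alone, and \<psi> qualifies because it
  is not an integer. The theorem also yields convergence of the two halves of the bilateral series
  separately, so frequencies j and -j may be paired afterwards. The four signs have two tasks. The
  difference between \<theta> and 1 - \<theta> completes half-cosets to full ones, with matching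
  signs because \<open>k + 1\<close> is even. The weight factor Y^(-(k+1)), with Y proportional to
  t, lowers the Mellin exponent from \<nu> + k + 1 to \<nu>: hence the Gamma value at \<nu> + k + 1
  beside a Bessel function of order \<nu>.\<close>

lemma Bessel_inequality:
  fixes g :: "'a \<Rightarrow> complex" and e :: "nat \<Rightarrow> 'a \<Rightarrow> complex"
  assumes fin: "finite_measure M"
    and [measurable]: "g \<in> borel_measurable M" "\<And>n. e n \<in> borel_measurable M"
    and g: "\<And>x. x \<in> space M \<Longrightarrow> cmod (g x) \<le> B"
    and e: "\<And>n x. x \<in> space M \<Longrightarrow> cmod (e n x) \<le> E"
    and orth: "\<And>m n. (\<integral>x. e m x * cnj (e n x) \<partial>M) = (if m = n then 1 else 0)"
  shows "(\<Sum>n<N. (cmod (\<integral>x. g x * cnj (e n x) \<partial>M))\<^sup>2) \<le> (\<integral>x. (cmod (g x))\<^sup>2 \<partial>M)"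
proof -
  interpret finite_measure M by (fact fin)
  define c where "c n = (\<integral>x. g x * cnj (e n x) \<partial>M)" for n
  define r where "r N x = g x - (\<Sum>n<N. c n * e n x)" for N x
  have [measurable]: "cnj \<in> borel_measurable borel"
    by (intro borel_measurable_continuous_onI continuous_intros)
  have [measurable]: "r N \<in> borel_measurable M" for N
    unfolding r_def by measurable
  have r_bound: "cmod (r N x) \<le> B + (\<Sum>n<N. cmod (c n) * E)" if "x \<in> space M" for N x
    unfolding r_def
    by (intro order_trans[OF norm_triangle_ineq4] add_mono g that order_trans[OF norm_sum] sum_mono)
       (auto simp: norm_mult intro!: mult_left_mono e that)
  have int_e: "integrable M (\<lambda>x. u x * cnj (e n x))"
    if "u \<in> borel_measurable M" "\<And>x. x \<in> space M \<Longrightarrow> cmod (u x) \<le> D" for u D n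
  proof (rule integrable_const_bound)
    show "AE x in M. cmod (u x * cnj (e n x)) \<le> D * E"
      using that(2) e by (intro AE_I2) (auto simp: norm_mult intro!: mult_mono order_trans[OF norm_ge_zero])
  next
    have [measurable]: "u \<in> borel_measurable M" by (fact that)
    show "(\<lambda>x. u x * cnj (e n x)) \<in> borel_measurable M" by measurable
  qed
  have int_ee: "integrable M (\<lambda>x. e m x * cnj (e n x))" for m n
    using e by (intro int_e) auto
  have int_rr: "integrable M (\<lambda>x. (cmod (r N x))\<^sup>2)" for N
  proof (rule integrable_const_bound)
    show "AE x in M. norm ((cmod (r N x))\<^sup>2) \<le> (B + (\<Sum>n<N. cmod (c n) * E))\<^sup>2"
      using r_bound by (intro AE_I2) (auto intro!: power_mono)
  qed measurable
  have int_re: "(\<integral>x. r N x * cnj (e N x) \<partial>M) = c N" for N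
  proof -
    have "(\<integral>x. r N x * cnj (e N x) \<partial>M)
        = (\<integral>x. g x * cnj (e N x) - (\<Sum>n<N. c n * (e n x * cnj (e N x))) \<partial>M)"
      by (intro Bochner_Integration.integral_cong) (auto simp: r_def algebra_simps sum_distrib_left)
    also have "\<dots> = c N - (\<Sum>n<N. c n * (\<integral>x. e n x * cnj (e N x) \<partial>M))"
      using int_e[OF _ g] int_ee
      by (subst Bochner_Integration.integral_diff)
         (auto simp: c_def[symmetric] Bochner_Integration.integral_sum)
    also have "(\<Sum>n<N. c n * (\<integral>x. e n x * cnj (e N x) \<partial>M)) = 0"
      by (intro sum.neutral) (auto simp: orth)
    finally show ?thesis by simp
  qed
  \<comment> \<open>Pythagoras: \<open>r N\<close> is what remains of \<open>g\<close> after
    projection onto the first \<open>N\<close> vectors, and by \<open>int_re\<close> its coefficient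
    along the next one is still \<open>c N\<close>. Removing it costs exactly the square of that
    coefficient.\<close>
  have step: "(\<integral>x. (cmod (r (Suc N) x))\<^sup>2 \<partial>M) = (\<integral>x. (cmod (r N x))\<^sup>2 \<partial>M) - (cmod (c N))\<^sup>2" for N
  proof -
    have i1: "integrable M (\<lambda>x. r N x * cnj (e N x))"
      by (rule int_e[OF _ r_bound]) auto
    have pt: "(cmod (r (Suc N) x))\<^sup>2 = (cmod (r N x))\<^sup>2 - 2 * Re (cnj (c N) * (r N x * cnj (e N x)))
        + (cmod (c N))\<^sup>2 * Re (e N x * cnj (e N x))" for x
    proof -
      have "(cmod (z - b * w))\<^sup>2 = (cmod z)\<^sup>2 - 2 * Re (cnj b * (z * cnj w)) + (cmod b)\<^sup>2 * Re (w * cnj w)" for z b w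
        by (simp only: cmod_power2 complex_mult_cnj Re_complex_of_real) (simp add: algebra_simps power2_eq_square)
      moreover have "r (Suc N) x = r N x - c N * e N x" by (simp add: r_def)
      ultimately show ?thesis by simp
    qed
    have "(\<integral>x. (cmod (r (Suc N) x))\<^sup>2 \<partial>M) = (\<integral>x. (cmod (r N x))\<^sup>2 \<partial>M)
        - 2 * Re (cnj (c N) * (\<integral>x. r N x * cnj (e N x) \<partial>M))
        + (cmod (c N))\<^sup>2 * Re (\<integral>x. e N x * cnj (e N x) \<partial>M)"
    proof -
      have "integrable M (\<lambda>x. Re (cnj (c N) * (r N x * cnj (e N x))))"
          "(\<integral>x. Re (cnj (c N) * (r N x * cnj (e N x))) \<partial>M)
             = Re (cnj (c N) * (\<integral>x. r N x * cnj (e N x) \<partial>M))"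
        using i1 by (simp_all only: integrable_Re integral_Re integrable_mult_right integral_mult_right_zero)
      moreover have "integrable M (\<lambda>x. Re (e N x * cnj (e N x)))"
          "(\<integral>x. Re (e N x * cnj (e N x)) \<partial>M) = Re (\<integral>x. e N x * cnj (e N x) \<partial>M)"
        using int_ee by (simp_all only: integrable_Re integral_Re)
      ultimately show ?thesis
        unfolding pt using int_rr
        by (simp only: Bochner_Integration.integral_add Bochner_Integration.integral_diff
            Bochner_Integration.integrable_diff integrable_mult_right integral_mult_right_zero)
    qed
    also have "cnj (c N) * (\<integral>x. r N x * cnj (e N x) \<partial>M) = of_real ((cmod (c N))\<^sup>2)"
      unfolding int_re by (subst complex_norm_square) (simp add: mult.commute)
    finally show ?thesis by (simp add: orth)
  qed
  have "(\<integral>x. (cmod (r N x))\<^sup>2 \<partial>M) = (\<integral>x. (cmod (g x))\<^sup>2 \<partial>M) - (\<Sum>n<N. (cmod (c n))\<^sup>2)"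
  proof (induction N)
    case 0
    then show ?case by (simp add: r_def)
  qed (simp add: step)
  moreover have "(\<integral>x. (cmod (r N x))\<^sup>2 \<partial>M) \<ge> 0" by simp
  ultimately show ?thesis by (simp add: c_def)
qed

lemma Bessel_coefficients_tendsto_0:
  fixes g :: "'a \<Rightarrow> complex" and e :: "nat \<Rightarrow> 'a \<Rightarrow> complex"
  assumes "finite_measure M"
    and "g \<in> borel_measurable M" "\<And>n. e n \<in> borel_measurable M"
    and "\<And>x. x \<in> space M \<Longrightarrow> cmod (g x) \<le> B"
    and "\<And>n x. x \<in> space M \<Longrightarrow> cmod (e n x) \<le> E"
    and "\<And>m n. (\<integral>x. e m x * cnj (e n x) \<partial>M) = (if m = n then 1 else 0)"
  shows "(\<lambda>n. \<integral>x. g x * cnj (e n x) \<partial>M) \<longlonglongrightarrow> 0"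
proof -
  have "summable (\<lambda>n. (cmod (\<integral>x. g x * cnj (e n x) \<partial>M))\<^sup>2)"
    by (rule summableI_nonneg_bounded[OF _ Bessel_inequality[OF assms]]) auto
  hence "(\<lambda>n. (cmod (\<integral>x. g x * cnj (e n x) \<partial>M))\<^sup>2) \<longlonglongrightarrow> 0"
    by (rule summable_LIMSEQ_zero)
  hence "(\<lambda>n. sqrt ((cmod (\<integral>x. g x * cnj (e n x) \<partial>M))\<^sup>2)) \<longlonglongrightarrow> sqrt 0"
    by (rule tendsto_real_sqrt)
  thus ?thesis by (simp add: tendsto_norm_zero_iff)
qed

lemma set_integral_cis:
  "(LINT u:{0..1}|lborel. cis (2 * pi * of_int n * u)) = (if n = 0 then 1 else 0)"
proof (cases "n = 0")
  case True
  have "set_lebesgue_integral lborel {0..1::real} (\<lambda>u. 1::complex) = 1"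
    by (subst set_integral_const) auto
  with True show ?thesis by simp
next
  case False
  define F where "F u = cis (2 * pi * of_int n * u) / (2 * pi * of_int n * \<i>)" for u
  have "((\<lambda>u. cis (2 * pi * of_int n * u)) has_integral (F 1 - F 0)) {0..1}"
  proof (rule fundamental_theorem_of_calculus)
    show "(F has_vector_derivative cis (2 * pi * of_int n * u)) (at u within {0..1})" for u
      unfolding F_def cis_conv_exp using False
      by (auto intro!: derivative_eq_intros has_vector_derivative_real_field simp: field_simps)
  qed simp
  moreover have "F 1 = F 0"
    using cis_multiple_2pi[of "of_int n"] by (simp add: F_def)
  ultimately have "integral {0..1} (\<lambda>u. cis (2 * pi * of_int n * u)) = 0"
    by (simp add: integral_unique)
  moreover have "set_integrable lborel {0..1} (\<lambda>u. cis (2 * pi * of_int n * u))"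
    by (intro borel_integrable_atLeastAtMost' continuous_intros)
  ultimately show ?thesis
    using False by (simp add: set_borel_integral_eq_integral(2))
qed

definition fourier_coeff :: "(real \<Rightarrow> complex) \<Rightarrow> int \<Rightarrow> complex" where
  "fourier_coeff f n = (LINT u:{0..1}|lborel. f u * cis (- (2 * pi * of_int n * u)))"

text \<open>The Bessel inequality is indexed by \<open>nat\<close>, the coefficients by
  \<open>int\<close>. The sign \<open>s\<close> picks one half of the characters, which is an
  orthonormal system by itself.\<close>

lemma riemann_lebesgue_bounded:
  assumes meas: "g \<in> borel_measurable borel"
    and bound: "\<And>u. u \<in> {0..1} \<Longrightarrow> cmod (g u) \<le> B"
    and s: "s \<in> {1, -1::int}"
  shows "(\<lambda>n. fourier_coeff g (s * int n)) \<longlonglongrightarrow> 0"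
proof -
  define M where "M = restrict_space lborel {0..1::real}"
  define e where "e n u = cis (2 * pi * of_int (s * int n) * u)" for n and u :: real
  have sp: "space M = {0..1}" by (simp add: M_def space_restrict_space)
  have int_M: "integral\<^sup>L M f = (LINT u:{0..1}|lborel. f u)" for f :: "real \<Rightarrow> complex"
    unfolding M_def set_lebesgue_integral_def by (subst integral_restrict_space) auto
  have "(\<lambda>n. \<integral>x. g x * cnj (e n x) \<partial>M) \<longlonglongrightarrow> 0"
  proof (rule Bessel_coefficients_tendsto_0)
    show "finite_measure M"
      unfolding M_def by (intro finite_measure_restrict_space finite_measureI) (auto intro!: finite_measureI simp: emeasure_restrict_space space_restrict_space)
    show "g \<in> borel_measurable M"
      unfolding M_def using meas by (intro measurable_restrict_space1) simp
    have "e n \<in> borel_measurable borel" for n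
      unfolding e_def by (intro borel_measurable_continuous_onI continuous_intros)
    thus "e n \<in> borel_measurable M" for n
      unfolding M_def by (intro measurable_restrict_space1) simp
    show "cmod (g x) \<le> B" if "x \<in> space M" for x using that bound by (simp add: sp)
    show "cmod (e n x) \<le> 1" for n x by (simp add: e_def)
    show "(\<integral>x. e m x * cnj (e n x) \<partial>M) = (if m = n then 1 else 0)" for m n
    proof -
      have "e m x * cnj (e n x) = cis (2 * pi * of_int (s * (int m - int n)) * x)" for x
        unfolding e_def cis_cnj cis_mult by (simp add: algebra_simps)
      moreover have "s * (int m - int n) = 0 \<longleftrightarrow> m = n" using s by auto
      ultimately show ?thesis unfolding int_M by (simp only: set_integral_cis)
    qed
  qed
  thus ?thesis
    unfolding int_M fourier_coeff_def e_def cis_cnj .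
qed

text \<open>
  After subtracting \<open>L\<close>, the function is divisible by \<open>cis (2 * pi * (u - u0)) - 1\<close> with a bounded
  quotient \<open>g\<close>, so the terms of its Fourier series at \<open>u0\<close> are differences of consecutive
  coefficients of \<open>g\<close> (Chernoff's argument). Writing the regularity condition with a sine
  makes it insensitive to \<open>0\<close> and \<open>1\<close> being the same point of the circle.
\<close>

lemma fourier_series_at_point:
  assumes meas [measurable]: "f \<in> borel_measurable borel"
    and bound: "\<And>u. u \<in> {0..1} \<Longrightarrow> cmod (f u - L) \<le> C * \<bar>sin (pi * (u - u0))\<bar>"
  defines "d \<equiv> \<lambda>n. fourier_coeff f n * cis (2 * pi * of_int n * u0)"
  shows "\<exists>A. (\<lambda>n. d (int n)) sums A \<and> (\<lambda>n. d (- int n - 1)) sums (L - A)"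
proof -
  define g where "g u = (f u - L) / (cis (2 * pi * (u - u0)) - 1)" for u
  define c where "c n = fourier_coeff g n * cis (2 * pi * of_int n * u0)" for n
  have meas_cis [measurable]: "(\<lambda>u::real. cis (t * u)) \<in> borel_measurable borel" 
      "(\<lambda>u::real. cis (- (t * u))) \<in> borel_measurable borel"
      "(\<lambda>u::real. cis (t * (u - u0))) \<in> borel_measurable borel" for t
    by (intro borel_measurable_continuous_onI continuous_intros)+
  have [measurable]: "g \<in> borel_measurable borel"
    unfolding g_def by measurable
  have cis_norm: "cmod (cis (2 * pi * v) - 1) = 2 * \<bar>sin (pi * v)\<bar>" for v
    using dist_exp_i_1[of "2 * pi * v"] by (simp add: cis_conv_exp)
  \<comment> \<open>At a zero of the denominator division by zero makes \<open>g u = 0\<close>,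
    while the sine bound forces \<open>f u = L\<close>. The identity therefore holds on the whole
    closed interval.\<close>
  have g_eq: "f u = L + g u * (cis (2 * pi * (u - u0)) - 1)" if "u \<in> {0..1}" for u
  proof (cases "cis (2 * pi * (u - u0)) - 1 = 0")
    case True
    hence "sin (pi * (u - u0)) = 0" using cis_norm[of "u - u0"] by simp
    thus ?thesis using bound[OF that] True by simp
  qed (simp add: g_def)
  have g_bound: "cmod (g u) \<le> \<bar>C\<bar>" if "u \<in> {0..1}" for u
  proof (cases "cis (2 * pi * (u - u0)) - 1 = 0")
    case False
    hence "sin (pi * (u - u0)) \<noteq> 0" using cis_norm[of "u - u0"] by fastforce
    moreover have "C * \<bar>sin (pi * (u - u0))\<bar> \<le> \<bar>C\<bar> * (2 * \<bar>sin (pi * (u - u0))\<bar>)"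
      by (intro mult_mono) auto
    hence "cmod (f u - L) \<le> \<bar>C\<bar> * (2 * \<bar>sin (pi * (u - u0))\<bar>)"
      using bound[OF that] by linarith
    ultimately show ?thesis
      by (simp add: g_def norm_divide cis_norm pos_divide_le_eq)
  qed (simp add: g_def)
  have int_g: "set_integrable lborel {0..1} (\<lambda>u. g u * cis (- (2 * pi * t * u)))" for t
    unfolding set_integrable_def
  proof (rule integrableI_bounded_set[where A = "{0..1}" and B = "\<bar>C\<bar>"])
    show "AE x\<in>{0..1} in lborel. cmod (indicat_real {0..1} x *\<^sub>R (g x * cis (- (2 * pi * t * x)))) \<le> \<bar>C\<bar>"
      using g_bound by (intro AE_I2) (auto simp: norm_mult)
  qed (auto simp: indicator_def)
  \<comment> \<open>Multiplication by the character \<open>cis (2 * pi * (u - u0))\<close> shifts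
    the index of a Fourier coefficient by one, and the constant \<open>L\<close> is seen by index 0
    only.\<close>
  have d_eq: "d n = (if n = 0 then L else 0) + c (n - 1) - c n" for n
  proof -
    have int_L: "set_integrable lborel {0..1} (\<lambda>u. L * cis (- (2 * pi * of_int n * u)))"
      by (intro borel_integrable_atLeastAtMost' continuous_intros)
    have "fourier_coeff f n = (LINT u:{0..1}|lborel. L * cis (- (2 * pi * of_int n * u)) +
       (cis (- (2 * pi * u0)) * (g u * cis (- (2 * pi * of_int (n - 1) * u))) - g u * cis (- (2 * pi * of_int n * u))))"
      unfolding fourier_coeff_def
    proof (rule set_lebesgue_integral_cong; safe?)
      fix u :: real assume u: "u \<in> {0..1}"
      have "cis (- (2 * pi * u0)) * cis (- (2 * pi * of_int (n - 1) * u))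
         = cis (2 * pi * (u - u0)) * cis (- (2 * pi * of_int n * u))"
        unfolding cis_mult by (simp add: algebra_simps)
      hence *: "cis (- (2 * pi * u0)) * (g u * cis (- (2 * pi * of_int (n - 1) * u)))
         = g u * cis (2 * pi * (u - u0)) * cis (- (2 * pi * of_int n * u))"
        by (metis mult.assoc mult.left_commute)
      show "f u * cis (- (2 * pi * of_int n * u)) = L * cis (- (2 * pi * of_int n * u)) +
       (cis (- (2 * pi * u0)) * (g u * cis (- (2 * pi * of_int (n - 1) * u))) - g u * cis (- (2 * pi * of_int n * u)))"
        unfolding g_eq[OF u] * by (simp add: algebra_simps)
    qed simp
    also have "\<dots> = (LINT u:{0..1}|lborel. L * cis (- (2 * pi * of_int n * u)))
       + (cis (- (2 * pi * u0)) * fourier_coeff g (n - 1) - fourier_coeff g n)"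
      using int_g[of "of_int (n - 1)"] int_g[of "of_int n"] int_L
      by (simp add: fourier_coeff_def set_integral_add set_integral_diff)
    also have "(LINT u:{0..1}|lborel. L * cis (- (2 * pi * of_int n * u))) = (if n = 0 then L else 0)"
      using set_integral_cis[of "- n"] by simp
    finally have "d n = ((if n = 0 then L else 0) +
        (cis (- (2 * pi * u0)) * fourier_coeff g (n - 1) - fourier_coeff g n)) * cis (2 * pi * of_int n * u0)"
      by (simp only: d_def)
    also have "\<dots> = (if n = 0 then L else 0) * cis (2 * pi * of_int n * u0)
       + fourier_coeff g (n - 1) * (cis (- (2 * pi * u0)) * cis (2 * pi * of_int n * u0)) - c n"
      unfolding c_def by (simp only: ring_distribs mult_ac add_diff_eq)
    also have "cis (- (2 * pi * u0)) * cis (2 * pi * of_int n * u0) = cis (2 * pi * of_int (n - 1) * u0)"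
      unfolding cis_mult by (simp add: algebra_simps)
    finally show ?thesis by (simp add: c_def)
  qed
  have "cmod (c n) = cmod (fourier_coeff g n)" for n by (simp add: c_def norm_mult)
  hence c_lim: "(\<lambda>n. c (a n)) \<longlonglongrightarrow> 0" if "(\<lambda>n. fourier_coeff g (a n)) \<longlonglongrightarrow> 0" for a :: "nat \<Rightarrow> int"
    using that by (simp add: tendsto_norm_zero_iff[symmetric, of "\<lambda>n. c (a n)"] tendsto_norm_zero)
  have cp: "(\<lambda>n. c (1 * int n)) \<longlonglongrightarrow> 0" and cm: "(\<lambda>n. c (- 1 * int n)) \<longlonglongrightarrow> 0"
    by (rule c_lim, rule riemann_lebesgue_bounded[OF _ g_bound]; simp)+
  have cp': "(\<lambda>n. c (int n - 1)) \<longlonglongrightarrow> 0"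
    using cp by (subst filterlim_sequentially_Suc[symmetric]) simp
  have cm': "(\<lambda>n. c (- int n - 1)) \<longlonglongrightarrow> 0"
  proof -
    have "- 1 * int (Suc n) = - int n - 1" for n by simp
    thus ?thesis using LIMSEQ_Suc[OF cm] by (simp only:)
  qed
  \<comment> \<open>The two halves telescope independently, since \<open>c\<close> tends to 0 in
    both directions. The witness is A = L + c(-1), and the negative half sums to -c(-1).\<close>
  have "(\<lambda>n. c (int n - 1) - c (int (Suc n) - 1)) sums (c (int 0 - 1) - 0)"
    by (rule telescope_sums'[OF cp'])
  hence "(\<lambda>n. c (int n - 1) - c (int n)) sums c (-1)" by simp
  hence "(\<lambda>n. (if n = 0 then L else 0) + (c (int n - 1) - c (int n))) sums (L + c (-1))"
    by (intro sums_add sums_single)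
  hence 1: "(\<lambda>n. d (int n)) sums (L + c (-1))" by (simp add: d_eq algebra_simps)
  have "(\<lambda>n. c (- int (Suc n) - 1) - c (- int n - 1)) sums (0 - c (- int 0 - 1))"
    by (rule telescope_sums[OF cm'])
  hence 2: "(\<lambda>n. d (- int n - 1)) sums (L - (L + c (-1)))"
    by (simp add: d_eq algebra_simps)
  from 1 2 show ?thesis by blast
qed

section \<open>Poisson summation on the half-line\<close>

text \<open>Both integrals are sums over unit intervals, and \<open>B n\<close> bounds the integral
  of the norm over the n-th one, so sums and integrals may be exchanged. The half-open intervals
  \<open>A n\<close> partition the half-line, whereas the translates \<open>G n\<close> live on the
  closed unit interval. The mismatch is a single point of measure zero.\<close>

lemma set_integral_unfold_unit_intervals:
  fixes \<Psi> :: "real \<Rightarrow> complex"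
  assumes [measurable]: "\<Psi> \<in> borel_measurable borel"
    and bound: "\<And>n u. u \<in> {0..1} \<Longrightarrow> cmod (\<Psi> (real n + u)) \<le> B n"
    and "summable B"
  shows "set_integrable lborel {0..} \<Psi>"
    and "(LINT u:{0..1}|lborel. (\<Sum>n. \<Psi> (real n + u))) = (LINT u:{0..}|lborel. \<Psi> u)"
proof -
  define A where "A n = {real n..<real n + 1}" for n
  define F where "F n u = indicator (A n) u *\<^sub>R \<Psi> u" for n u
  define G where "G n u = indicator {0..1} u *\<^sub>R \<Psi> (real n + u)" for n u
  have B_nonneg: "B n \<ge> 0" for n
    using bound[of 0 n] order_trans[OF norm_ge_zero] by simp
  have F_norm: "cmod (F n u) \<le> indicator (A n) u * B n" for n u
    using bound[of "u - real n" n] by (auto simp: F_def A_def indicator_def)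
  have G_norm: "cmod (G n u) \<le> indicator {0..1} u * B n" for n u
    using bound[of u n] by (auto simp: G_def indicator_def)
  have [measurable]: "F n \<in> borel_measurable lborel" "G n \<in> borel_measurable lborel" for n
    unfolding F_def G_def A_def by measurable
  have int_ind: "integrable lborel (\<lambda>u. indicator S u * b :: real)"
      "(LINT u|lborel. indicator S u * b) = b"
      if "S = A n \<or> S = {0..1}" for S n and b :: real
    using that by (auto simp: A_def)
  have F_int: "integrable lborel (F n)" for n
    by (rule Bochner_Integration.integrable_bound[OF int_ind(1)[of "A n" n "B n"]])
       (use F_norm in \<open>auto intro!: order_trans[OF F_norm] AE_I2\<close>)
  have G_int: "integrable lborel (G n)" for n
    by (rule Bochner_Integration.integrable_bound[OF int_ind(1)[of "{0..1}" n "B n"]])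
       (use G_norm in \<open>auto intro!: order_trans[OF G_norm] AE_I2\<close>)
  have F_norm_int: "(LINT u|lborel. cmod (F n u)) \<le> B n" for n
    by (rule order_trans[OF integral_mono[OF _ int_ind(1)[of "A n" n "B n"] F_norm]])
       (use F_int int_ind(2)[of "A n" n "B n"] in auto)
  have G_norm_int: "(LINT u|lborel. cmod (G n u)) \<le> B n" for n
    by (rule order_trans[OF integral_mono[OF _ int_ind(1)[of "{0..1}" n "B n"] G_norm]])
       (use G_int int_ind(2)[of "{0..1}" n "B n"] in auto)
  have A_iff: "u \<in> A n \<longleftrightarrow> n = nat \<lfloor>u\<rfloor> \<and> u \<ge> 0" for u n
    unfolding A_def by (auto; linarith)
  have F_sums: "(\<lambda>n. F n u) sums (indicator {0..} u *\<^sub>R \<Psi> u)" for u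
  proof -
    have "(\<lambda>n. F n u) = (\<lambda>n. if n = nat \<lfloor>u\<rfloor> then indicator {0..} u *\<^sub>R \<Psi> u else 0)"
      by (auto simp: F_def A_iff indicator_def)
    thus ?thesis using sums_single[of "nat \<lfloor>u\<rfloor>" "\<lambda>_. indicator {0..} u *\<^sub>R \<Psi> u"] by simp
  qed
  have F_abs: "summable (\<lambda>n. cmod (F n u))" for u
  proof (rule summable_finite)
    show "finite {nat \<lfloor>u\<rfloor>}" by simp
  qed (auto simp: F_def A_iff)
  have F_sum: "summable (\<lambda>n. LINT u|lborel. cmod (F n u))"
    by (rule summable_comparison_test[OF _ \<open>summable B\<close>]) (use F_norm_int in auto)
  have G_abs: "summable (\<lambda>n. cmod (G n u))" for u
  proof (rule summable_comparison_test[OF _ \<open>summable B\<close>], intro exI allI impI)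
    show "norm (cmod (G n u)) \<le> B n" for n
      using G_norm[of n u] B_nonneg[of n] by (cases "u \<in> {0..1}") auto
  qed
  have G_sum: "summable (\<lambda>n. LINT u|lborel. cmod (G n u))"
    by (rule summable_comparison_test[OF _ \<open>summable B\<close>]) (use G_norm_int in auto)
  have F_suminf: "(\<Sum>n. F n u) = indicator {0..} u *\<^sub>R \<Psi> u" for u
    using F_sums by (rule sums_unique[symmetric])
  have G_suminf: "(\<Sum>n. G n u) = indicator {0..1} u *\<^sub>R (\<Sum>n. \<Psi> (real n + u))" for u
    by (simp add: G_def indicator_def)
  show "set_integrable lborel {0..} \<Psi>"
    unfolding set_integrable_def F_suminf[symmetric]
    by (rule integrable_suminf) (use F_int F_abs F_sum in auto)
  have GF: "(LINT u|lborel. G n u) = (LINT u|lborel. F n u)" for n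
  proof -
    have "(LINT u|lborel. F n u) = (LINT u|lborel. F n (real n + 1 * u))"
      by (subst lborel_integral_real_affine[of 1 _ "real n"]) auto
    also have "\<dots> = (LINT u|lborel. G n u)"
    proof (rule integral_cong_AE)
      show "AE u in lborel. F n (real n + 1 * u) = G n u"
        using AE_lborel_singleton[of "1::real"]
        by eventually_elim (auto simp: F_def G_def A_def indicator_def)
    qed measurable
    finally show ?thesis by simp
  qed
  have "(LINT u:{0..1}|lborel. (\<Sum>n. \<Psi> (real n + u))) = (\<Sum>n. LINT u|lborel. G n u)"
    unfolding set_lebesgue_integral_def G_suminf[symmetric]
    by (rule integral_suminf) (use G_int G_abs G_sum in auto)
  also have "(\<Sum>n. LINT u|lborel. G n u) = (\<Sum>n. LINT u|lborel. F n u)"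
    by (simp only: GF)
  also have "(\<Sum>n. LINT u|lborel. F n u) = (LINT u|lborel. (\<Sum>n. F n u))"
    by (rule integral_suminf[symmetric]) (use F_int F_abs F_sum in auto)
  also have "\<dots> = (LINT u:{0..}|lborel. \<Psi> u)"
    unfolding F_suminf set_lebesgue_integral_def ..
  finally show "(LINT u:{0..1}|lborel. (\<Sum>n. \<Psi> (real n + u))) = (LINT u:{0..}|lborel. \<Psi> u)" .
qed

text \<open>Characters of integer frequency do not notice integer translations, so the Fourier
  coefficients of the periodization are Fourier integrals of \<open>\<Phi>\<close> over the
  half-line. Regularity is demanded of the periodization at \<open>u0\<close> only;
  \<open>\<Phi>\<close> itself may jump elsewhere.\<close>

lemma poisson_summation_half_line:
  fixes \<Phi> :: "real \<Rightarrow> complex"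
  assumes meas [measurable]: "\<Phi> \<in> borel_measurable borel"
    and bound: "\<And>n u. u \<in> {0..1} \<Longrightarrow> cmod (\<Phi> (real n + u)) \<le> B n"
    and B: "summable B"
    and lip: "\<And>u. u \<in> {0..1} \<Longrightarrow>
      cmod ((\<Sum>n. \<Phi> (real n + u)) - L) \<le> C * \<bar>sin (pi * (u - u0))\<bar>"
  defines "c \<equiv> \<lambda>n. (LINT u:{0..}|lborel. \<Phi> u * cis (- (2 * pi * of_int n * u)))
                 * cis (2 * pi * of_int n * u0)"
  shows "\<exists>A. (\<lambda>n. c (int n)) sums A \<and> (\<lambda>n. c (- int n - 1)) sums (L - A)"
proof -
  have [measurable]: "(\<lambda>u::real. cis (- (t * u))) \<in> borel_measurable borel" for t
    by (intro borel_measurable_continuous_onI continuous_intros)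
  have "fourier_coeff (\<lambda>u. \<Sum>n. \<Phi> (real n + u)) m
      = (LINT u:{0..}|lborel. \<Phi> u * cis (- (2 * pi * of_int m * u)))" for m
  proof -
    have per: "cis (- (2 * pi * of_int m * (real n + u))) = cis (- (2 * pi * of_int m * u))" for n u
    proof -
      have "cis (- (2 * pi * of_int m * (real n + u))) = cis (2 * pi * of_int (- m * int n)) * cis (- (2 * pi * of_int m * u))"
        unfolding cis_mult by (simp add: algebra_simps)
      also have "cis (2 * pi * of_int (- m * int n)) = 1"
        by (rule cis_multiple_2pi) (rule Ints_of_int)
      finally show ?thesis by simp
    qed
    have "fourier_coeff (\<lambda>u. \<Sum>n. \<Phi> (real n + u)) m
      = (LINT u:{0..1}|lborel. (\<Sum>n. \<Phi> (real n + u) * cis (- (2 * pi * of_int m * (real n + u)))))"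
      unfolding fourier_coeff_def per
    proof (rule set_lebesgue_integral_cong, safe)
      fix u :: real assume "u \<in> {0..1}"
      hence "summable (\<lambda>n. \<Phi> (real n + u))"
        by (intro summable_comparison_test[OF _ B] exI[of _ 0]) (use bound in auto)
      thus "(\<Sum>n. \<Phi> (real n + u)) * cis (- (2 * pi * of_int m * u))
         = (\<Sum>n. \<Phi> (real n + u) * cis (- (2 * pi * of_int m * u)))"
        by (rule suminf_mult2)
    qed simp
    also have "\<dots> = (LINT u:{0..}|lborel. \<Phi> u * cis (- (2 * pi * of_int m * u)))"
      by (rule set_integral_unfold_unit_intervals[OF _ _ B])
         (use bound in \<open>auto simp: norm_mult\<close>)
    finally show ?thesis .
  qed
  moreover have "(\<lambda>u. \<Sum>n. \<Phi> (real n + u)) \<in> borel_measurable borel" by measurable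
  ultimately show ?thesis
    using fourier_series_at_point[of "\<lambda>u. \<Sum>n. \<Phi> (real n + u)" L C u0] lip
    by (simp add: c_def)
qed

section \<open>Powers times exponentials: decay, derivative and Laplace integral\<close>

lemma power_div_fact_le_exp:
  fixes x :: real
  assumes "x \<ge> 0"
  shows "x ^ p \<le> fact p * exp x"
proof -
  have s: "(\<lambda>n. x ^ n /\<^sub>R fact n) sums exp x" by (rule exp_converges)
  have "(\<Sum>n\<in>{p}. x ^ n /\<^sub>R fact n) \<le> (\<Sum>n. x ^ n /\<^sub>R fact n)"
    by (rule sum_le_suminf) (use s assms in \<open>auto simp: sums_iff\<close>)
  hence "x ^ p / fact p \<le> exp x" using s by (simp add: sums_iff divide_inverse mult.commute)
  thus ?thesis by (simp add: field_simps)
qed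

lemma summable_power_mult_exp:
  fixes s :: real
  assumes "s > 0"
  shows "summable (\<lambda>n. (real n + 1) ^ k * exp (- (s * real n)))"
proof (rule summable_comparison_test)
  \<comment> \<open>The term of degree k + 2 in the series of exp (s (n + 1)) beats the k-th power
    by two degrees, which leaves a multiple of 1/(n + 1)^2. The factor \<open>exp s\<close> pays for
    the shift from n to n + 1.\<close>
  define K where "K = exp s * fact (k + 2) / s ^ (k + 2)"
  show "summable (\<lambda>n. K * inverse (real (Suc n) ^ 2))"
    by (intro summable_mult summable_Suc_iff[THEN iffD2] inverse_power_summable) auto
  have "(real n + 1) ^ k * exp (- (s * real n)) \<le> K * inverse (real (Suc n) ^ 2)" for n
  proof -
    define x where "x = real n + 1"
    have x: "x > 0" by (simp add: x_def)
    have "(s * x) ^ (k + 2) \<le> fact (k + 2) * exp (s * x)"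
      using assms x by (intro power_div_fact_le_exp) auto
    hence "x ^ k \<le> fact (k + 2) * exp (s * x) / (s ^ (k + 2) * x ^ 2)"
      using x assms by (simp only: power_mult_distrib power_add[of x k 2]) (simp add: field_simps)
    hence "x ^ k * exp (- (s * real n)) \<le> fact (k + 2) * exp (s * x) / (s ^ (k + 2) * x ^ 2) * exp (- (s * real n))"
      by (intro mult_right_mono) auto
    also have "\<dots> = fact (k + 2) * (exp (s * x) * exp (- (s * real n))) / (s ^ (k + 2) * x ^ 2)"
      by (simp only: mult_ac times_divide_eq_left times_divide_eq_right)
    also have "exp (s * x) * exp (- (s * real n)) = exp s"
      by (subst exp_add[symmetric]) (simp add: x_def algebra_simps)
    also have "fact (k + 2) * exp s / (s ^ (k + 2) * x ^ 2) = K * inverse (x ^ 2)"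
      unfolding K_def by (simp only: divide_inverse inverse_mult_distrib mult_ac)
    finally have "x ^ k * exp (- (s * real n)) \<le> K * inverse (x ^ 2)" .
    thus ?thesis by (simp add: x_def add.commute)
  qed
  thus "\<exists>N. \<forall>n\<ge>N. norm ((real n + 1) ^ k * exp (- (s * real n))) \<le> K * inverse (real (Suc n) ^ 2)"
    by auto
qed

text \<open>The parameter \<open>z\<close> is complex so that a Fourier character can be absorbed:
  multiplication by it only changes the imaginary part of \<open>z\<close>, see
  \<open>power_exp_mult_cis\<close>.\<close>

definition power_exp :: "nat \<Rightarrow> complex \<Rightarrow> real \<Rightarrow> complex" where
  "power_exp k z x = of_real x ^ k * exp (- (z * of_real x))"

lemma continuous_power_exp: "continuous_on A (power_exp k z)"
  unfolding power_exp_def by (intro continuous_intros)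

lemma borel_measurable_power_exp [measurable]: "power_exp k z \<in> borel_measurable borel"
  by (intro borel_measurable_continuous_onI continuous_power_exp)

lemma norm_power_exp: "cmod (power_exp k z x) = \<bar>x\<bar> ^ k * exp (- (Re z * x))"
  by (simp add: power_exp_def norm_mult norm_power)

lemma norm_power_exp_le:
  assumes "Re z > 0" "u \<in> {0..1}"
  shows "cmod (power_exp k z (real n + u)) \<le> (real n + 1) ^ k * exp (- (Re z * real n))"
  unfolding norm_power_exp using assms
  by (intro mult_mono power_mono) auto

lemma set_integrable_power_exp:
  assumes "Re z > 0"
  shows "set_integrable lborel {0..} (power_exp k z)"
  by (rule set_integral_unfold_unit_intervals(1)[OF _ norm_power_exp_le summable_power_mult_exp])
     (use assms in auto)

lemma has_vector_derivative_power_exp: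
  "(power_exp k z has_vector_derivative (of_nat k * power_exp (k - 1) z x - z * power_exp k z x)) (at x within A)"
proof -
  have "((\<lambda>w. w ^ k * exp (- (z * w))) has_field_derivative
      (of_nat k * of_real x ^ (k - 1) * exp (- (z * of_real x)) - z * (of_real x ^ k * exp (- (z * of_real x)))))
     (at (of_real x))"
    by (auto intro!: derivative_eq_intros simp: algebra_simps)
  from has_vector_derivative_real_field[OF this]
  have "((\<lambda>x. of_real x ^ k * exp (- (z * of_real x))) has_vector_derivative
      (of_nat k * of_real x ^ (k - 1) * exp (- (z * of_real x)) - z * (of_real x ^ k * exp (- (z * of_real x)))))
     (at x within A)" .
  thus ?thesis by (simp add: power_exp_def[abs_def] mult.assoc)
qed

lemma tendsto_power_exp_at_top:
  assumes "Re z > 0"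
  shows "(power_exp k z \<longlongrightarrow> 0) at_top"
proof (rule Lim_null_comparison)
  define s where "s = Re z"
  have s: "s > 0" using assms by (simp add: s_def)
  show "\<forall>\<^sub>F x in at_top. cmod (power_exp k z x) \<le> fact (k + 1) / s ^ (k + 1) * inverse x"
    using eventually_gt_at_top[of 0]
  proof eventually_elim
    case (elim x)
    have "(s * x) ^ (k + 1) \<le> fact (k + 1) * exp (s * x)"
      using s elim by (intro power_div_fact_le_exp) auto
    thus ?case using elim s
      unfolding norm_power_exp s_def[symmetric] exp_minus
      by (simp add: divide_simps power_mult_distrib mult_ac)
  qed
  show "((\<lambda>x. fact (k + 1) / s ^ (k + 1) * inverse x) \<longlongrightarrow> 0) at_top"
    by (intro tendsto_mult_right_zero tendsto_inverse_0_at_top filterlim_ident)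
qed

text \<open>Integrating the derivative of \<open>power_exp k z\<close> over the half-line gives the
  recursion z I(k) = k I(k - 1) plus the value at 0, which is nonzero for k = 0 only.\<close>

lemma set_integral_power_exp:
  assumes z: "Re z > 0"
  shows "(LINT x:{0..}|lborel. power_exp k z x) = fact k / z ^ (k + 1)"
proof (induction k)
  have int: "set_integrable lborel {0..} (power_exp j z)" for j
    using z by (rule set_integrable_power_exp)
  have ftc: "of_nat k * (LINT x:{0..}|lborel. power_exp (k - 1) z x)
      - z * (LINT x:{0..}|lborel. power_exp k z x) = - power_exp k z 0" for k
  proof -
    define f where "f x = of_nat k * power_exp (k - 1) z x - z * power_exp k z x" for x
    have f_int: "set_integrable lborel {0..} f"
      unfolding f_def using int by (intro set_integral_diff set_integrable_mult_right)
    have cont: "continuous_on UNIV (power_exp j z)" for j by (rule continuous_power_exp)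
    hence cont': "isCont (power_exp j z) x" for j x
      by (simp add: continuous_on_eq_continuous_at)
    have "(LBINT x=ereal 0..\<infinity>. f x) = 0 - power_exp k z 0"
    proof (rule interval_integral_FTC_integrable)
      show "(power_exp k z has_vector_derivative f x) (at x)" for x
        unfolding f_def by (rule has_vector_derivative_power_exp)
      show "isCont f x" for x
        unfolding f_def using cont' by (intro continuous_intros)
      show "set_integrable lborel (einterval (ereal 0) \<infinity>) f"
        by (rule set_integrable_subset[OF f_int]) (auto simp: einterval_iff)
      show "((power_exp k z \<circ> real_of_ereal) \<longlongrightarrow> 0) (at_left \<infinity>)"
        unfolding ereal_tendsto_simps1 using z by (rule tendsto_power_exp_at_top)
      show "((power_exp k z \<circ> real_of_ereal) \<longlongrightarrow> power_exp k z 0) (at_right (ereal 0))"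
        unfolding ereal_tendsto_simps1
        using cont'[where j = k and x = 0] by (simp add: continuous_at filterlim_at_split)
    qed simp
    also have "(LBINT x=ereal 0..\<infinity>. f x) = (LINT x:{0..}|lborel. f x)"
      unfolding interval_integral_to_infinity_eq
    proof (rule set_integral_cong_set)
      show "set_borel_measurable lborel {0..} f"
        unfolding set_borel_measurable_def f_def by measurable
      show "set_borel_measurable lborel {0<..} f"
        unfolding set_borel_measurable_def f_def by measurable
      show "AE x in lborel. (x \<in> {0..}) = (x \<in> {0::real<..})"
        using AE_lborel_singleton[of "0::real"] by eventually_elim auto
    qed
    also have "\<dots> = of_nat k * (LINT x:{0..}|lborel. power_exp (k - 1) z x)
      - z * (LINT x:{0..}|lborel. power_exp k z x)"
      unfolding f_def using int by (subst set_integral_diff) auto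
    finally show ?thesis by simp
  qed
  have z0: "z \<noteq> 0" using z by auto
  {
    case 0
    \<comment> \<open>Here 0^0 = 1 provides the boundary value 1, and the factor
      \<open>of_nat 0\<close> removes the term with the truncated index
      \<open>0 - 1\<close>.\<close>
    show ?case using ftc[of 0] z0 by (simp add: power_exp_def field_simps)
  next
    case (Suc k)
    have "power_exp (Suc k) z 0 = 0" by (simp add: power_exp_def)
    with ftc[of "Suc k"] Suc.IH
    have "z * (LINT x:{0..}|lborel. power_exp (Suc k) z x) = of_nat (Suc k) * (fact k / z ^ (k + 1))"
      by simp
    thus ?case using z0 by (simp add: field_simps)
  }
qed

text \<open>The left side is the distance from \<open>x\<close> to the nearest integer. This turns
  Lipschitz bounds measured along the circle into the sine form that
  \<open>fourier_series_at_point\<close> expects.\<close>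

lemma sin_pi_ge_min:
  assumes "\<bar>x\<bar> \<le> 1"
  shows "min \<bar>x\<bar> (1 - \<bar>x\<bar>) \<le> \<bar>sin (pi * x)\<bar>"
proof -
  have half: "y \<le> sin (pi * y)" if "0 \<le> y" "y \<le> 1/2" for y :: real
  proof -
    define t where "t = pi * y"
    have t: "0 \<le> t" "t \<le> pi / 2" using that by (auto simp: t_def)
    \<comment> \<open>Up to pi/6 the derivative cos t - 1/2 of sin t - t/2 is nonnegative, and t/pi
      is at most t/2. Beyond pi/6 the value 1/2 separates the two sides.\<close>
    have "t / pi \<le> sin t"
    proof (cases "t \<le> pi / 6")
      case True
      have "sin 0 - 0 / 2 \<le> sin t - t / 2"
      proof (rule DERIV_nonneg_imp_nondecreasing[OF t(1)])
        fix x assume x: "0 \<le> x" "x \<le> t"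
        have "cos (pi / 3) \<le> cos x"
          using x True by (intro cos_monotone_0_pi_le) auto
        hence "cos x - 1 / 2 \<ge> 0" by (simp add: cos_60)
        moreover have "((\<lambda>x. sin x - x / 2) has_real_derivative cos x - 1 / 2) (at x)"
          by (auto intro!: derivative_eq_intros)
        ultimately show "\<exists>d. ((\<lambda>x. sin x - x / 2) has_real_derivative d) (at x) \<and> 0 \<le> d"
          by blast
      qed
      hence "t / 2 \<le> sin t" by simp
      moreover have "t / pi \<le> t / 2"
        using t pi_gt3 by (intro divide_left_mono) auto
      ultimately show ?thesis by linarith
    next
      case False
      have "sin (pi / 6) \<le> sin t"
        using False t by (intro sin_monotone_2pi_le) auto
      moreover have "t / pi \<le> 1 / 2" using t by (simp add: field_simps)
      ultimately have "1 / 2 \<le> sin t" "t / pi \<le> 1 / 2" by (simp_all only: sin_30)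
      thus ?thesis by linarith
    qed
    thus ?thesis by (simp add: t_def)
  qed
  have "min \<bar>x\<bar> (1 - \<bar>x\<bar>) \<le> sin (pi * \<bar>x\<bar>)"
  proof (cases "\<bar>x\<bar> \<le> 1/2")
    case True
    thus ?thesis using half[of "\<bar>x\<bar>"] by auto
  next
    case False
    have "sin (pi * (1 - \<bar>x\<bar>)) = sin (pi * \<bar>x\<bar>)"
      by (simp add: right_diff_distrib)
    with False show ?thesis using half[of "1 - \<bar>x\<bar>"] assms by auto
  qed
  also have "sin (pi * \<bar>x\<bar>) \<le> \<bar>sin (pi * x)\<bar>"
    by (cases "x \<ge> 0") auto
  finally show ?thesis .
qed

section \<open>Lipschitz summation and its dual\<close>

lemma power_exp_mult_cis: "power_exp k z x * cis (- (t * x)) = power_exp k (z + \<i> * of_real t) x"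
  by (simp add: power_exp_def cis_conv_exp exp_add[symmetric] algebra_simps)

text \<open>Mean value inequality. Because \<open>b\<close> is at least 1, \<open>b ^ k\<close>
  dominates both powers in the derivative, and the exponential is largest at the left end
  \<open>a\<close>.\<close>

lemma norm_power_exp_diff_le:
  assumes a: "0 \<le> a" and b: "1 \<le> b" and z: "Re z > 0" and xy: "x \<in> {a..b}" "y \<in> {a..b}"
  shows "cmod (power_exp k z x - power_exp k z y) \<le> (real k + cmod z) * b ^ k * exp (- (Re z * a)) * \<bar>x - y\<bar>"
proof -
  define d where "d x = of_nat k * power_exp (k - 1) z x - z * power_exp k z x" for x
  have "norm (power_exp k z x - power_exp k z y) \<le> ((real k + cmod z) * b ^ k * exp (- (Re z * a))) * norm (x - y)"
  proof (rule differentiable_bound[of "{a..b}"])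
    show "(power_exp k z has_derivative (\<lambda>h. h *\<^sub>R d x)) (at x within {a..b})" for x
      using has_vector_derivative_power_exp unfolding d_def has_vector_derivative_def .
    fix x assume x: "x \<in> {a..b}"
    have pe: "cmod (power_exp j z x) \<le> b ^ k * exp (- (Re z * a))" if "j \<le> k" for j
    proof -
      have "x ^ j \<le> b ^ j" using x a by (intro power_mono) auto
      also have "\<dots> \<le> b ^ k" using that b by (intro power_increasing) auto
      finally show ?thesis
        unfolding norm_power_exp using x a z by (intro mult_mono) auto
    qed
    have "cmod (d x) \<le> real k * (b ^ k * exp (- (Re z * a))) + cmod z * (b ^ k * exp (- (Re z * a)))"
      unfolding d_def using pe[of k] pe[of "k - 1"]
      by (intro order_trans[OF norm_triangle_ineq4] add_mono) (auto simp: norm_mult intro!: mult_left_mono)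
    hence "cmod (d x) \<le> (real k + cmod z) * b ^ k * exp (- (Re z * a))" by (simp add: algebra_simps)
    thus "onorm (\<lambda>h. h *\<^sub>R d x) \<le> (real k + cmod z) * b ^ k * exp (- (Re z * a))"
      by (intro onorm_le) (metis mult.commute mult_right_mono norm_ge_zero norm_scaleR real_norm_def)
  qed (use xy in auto)
  thus ?thesis by simp
qed

text \<open>Poisson summation for x^k e^(-z x) at the point 0, the Fourier integrals being Laplace
  integrals with shifted \<open>z\<close>. As \<open>k\<close> is at least 1 the function vanishes
  at 0, so extending it by 0 creates no jump and the periodization is Lipschitz on the
  circle.\<close>

lemma lipschitz_summation:
  assumes z: "Re z > 0" and k: "k \<ge> 1"
  shows "\<exists>A. (\<lambda>n. fact k / (z + 2 * pi * \<i> * of_nat n) ^ (k + 1)) sums A \<and>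
    (\<lambda>n. fact k / (z - 2 * pi * \<i> * (of_nat n + 1)) ^ (k + 1)) sums
       ((\<Sum>n. of_nat n ^ k * exp (- (z * of_nat n))) - A)"
proof -
  define f where "f u = (\<Sum>n. power_exp k z (real n + u))" for u
  define s where "s = Re z"
  have s: "s > 0" using z by (simp add: s_def)
  define K where "K = (real k + cmod z) * (\<Sum>n. (real n + 1) ^ k * exp (- (s * real n)))"
  have summ: "summable (\<lambda>n. power_exp k z (real n + u))" if "u \<in> {0..1}" for u
    by (rule summable_comparison_test[OF _ summable_power_mult_exp[of "Re z"]])
       (use norm_power_exp_le[OF z that] z in auto)
  have f_lip: "cmod (f u - f v) \<le> K * \<bar>u - v\<bar>" if uv: "u \<in> {0..1}" "v \<in> {0..1}" for u v
  proof -
    have "f u - f v = (\<Sum>n. power_exp k z (real n + u) - power_exp k z (real n + v))"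
      unfolding f_def by (rule suminf_diff) (use summ uv in auto)
    also have "cmod \<dots> \<le> (\<Sum>n. (real k + cmod z) * ((real n + 1) ^ k * exp (- (s * real n))) * \<bar>u - v\<bar>)"
    proof (rule norm_suminf_le)
      show "cmod (power_exp k z (real n + u) - power_exp k z (real n + v))
         \<le> (real k + cmod z) * ((real n + 1) ^ k * exp (- (s * real n))) * \<bar>u - v\<bar>" for n
        using norm_power_exp_diff_le[of "real n" "real n + 1" z "real n + u" "real n + v" k] z uv
        by (simp add: s_def mult.assoc)
    qed (intro summable_mult summable_mult2 summable_power_mult_exp s)
    also have "\<dots> = K * \<bar>u - v\<bar>"
      unfolding K_def using summable_power_mult_exp[OF s, of k]
      by (simp add: suminf_mult suminf_mult2[symmetric] summable_mult)
    finally show ?thesis .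
  qed
  have f01: "f 1 = f 0"
  proof -
    have "f 0 = (\<Sum>n. power_exp k z (real (Suc n) + 0)) + power_exp k z (real 0 + 0)"
      unfolding f_def using summ[of 0] by (subst suminf_split_head) auto
    also have "power_exp k z (real 0 + 0) = 0" using k by (simp add: power_exp_def)
    finally show ?thesis by (simp add: f_def add.commute)
  qed
  have K: "K \<ge> 0"
    using f_lip[of 0 1] order_trans[OF norm_ge_zero] by simp
  have coeff: "(LINT u:{0..}|lborel. power_exp k z u * cis (- (2 * pi * of_int m * u)))
      = fact k / (z + 2 * pi * \<i> * of_int m) ^ (k + 1)" for m
    unfolding power_exp_mult_cis using z
    by (subst set_integral_power_exp) (auto simp: mult_ac)
  have "\<exists>A. (\<lambda>n. (LINT u:{0..}|lborel. power_exp k z u * cis (- (2 * pi * of_int (int n) * u)))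
                 * cis (2 * pi * of_int (int n) * 0)) sums A \<and>
    (\<lambda>n. (LINT u:{0..}|lborel. power_exp k z u * cis (- (2 * pi * of_int (- int n - 1) * u)))
                 * cis (2 * pi * of_int (- int n - 1) * 0)) sums (f 0 - A)"
  proof (rule poisson_summation_half_line)
    show "cmod (power_exp k z (real n + u)) \<le> (real n + 1) ^ k * exp (- (Re z * real n))"
      if "u \<in> {0..1}" for n u using norm_power_exp_le[OF z that] .
    show "cmod ((\<Sum>n. power_exp k z (real n + u)) - f 0) \<le> K * \<bar>sin (pi * (u - 0))\<bar>"
      if u: "u \<in> {0..1}" for u
    proof -
      \<comment> \<open>Near the right end of the interval the comparison is with
        \<open>f 1\<close>, which equals \<open>f 0\<close>.\<close>
      have "cmod (f u - f 0) \<le> K * min u (1 - u)"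
        using f_lip[OF u, of 0] f_lip[OF u, of 1] u f01 by (auto simp: min_def)
      also have "\<dots> \<le> K * \<bar>sin (pi * (u - 0))\<bar>"
        using sin_pi_ge_min[of u] u K by (intro mult_left_mono) auto
      finally show ?thesis by (simp add: f_def)
    qed
  qed (use summable_power_mult_exp[OF z] in auto)
  also have "(\<lambda>n. (LINT u:{0..}|lborel. power_exp k z u * cis (- (2 * pi * of_int (int n) * u)))
                 * cis (2 * pi * of_int (int n) * 0)) = (\<lambda>n. fact k / (z + 2 * pi * \<i> * of_nat n) ^ (k + 1))"
    unfolding coeff by (simp add: mult_ac)
  also have "(\<lambda>n. (LINT u:{0..}|lborel. power_exp k z u * cis (- (2 * pi * of_int (- int n - 1) * u)))
                 * cis (2 * pi * of_int (- int n - 1) * 0)) = (\<lambda>n. fact k / (z - 2 * pi * \<i> * (of_nat n + 1)) ^ (k + 1))"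
  proof -
    have "z + 2 * pi * \<i> * of_int (- int n - 1) = z - 2 * pi * \<i> * (of_nat n + 1)" for n
      by (simp add: algebra_simps)
    thus ?thesis unfolding coeff by (simp only: mult_zero_right cis_zero mult_1_right)
  qed
  also have "f 0 = (\<Sum>n. of_nat n ^ k * exp (- (z * of_nat n)))"
    by (simp add: f_def power_exp_def)
  finally show ?thesis .
qed

section \<open>The function of \<open>u\<close> already summed over \<open>v\<close>, and its
  Fourier integrals\<close>

definition power_exp_sum :: "nat \<Rightarrow> real \<Rightarrow> real \<Rightarrow> real \<Rightarrow> complex" where
  "power_exp_sum k Y \<alpha> x = (\<Sum>m. power_exp k (of_real (Y * (real m + \<alpha>))) x)"

text \<open>Up to the factor k! / Y^(k+1) this is the Hurwitz zeta value at k + 1 with complex shift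
  \<alpha> + 2 pi i n / Y, that is, half of a row of the Eisenstein lattice sum.\<close>

definition shifted_power_sum :: "nat \<Rightarrow> real \<Rightarrow> real \<Rightarrow> int \<Rightarrow> complex" where
  "shifted_power_sum k Y \<alpha> n
     = (\<Sum>m. fact k / (of_real (Y * (real m + \<alpha>)) + 2 * pi * \<i> * of_int n) ^ (k + 1))"

lemma borel_measurable_power_exp_sum [measurable]: "power_exp_sum k Y \<alpha> \<in> borel_measurable borel"
  unfolding power_exp_sum_def by measurable

lemma one_div_one_minus_exp_le:
  fixes x :: real
  assumes "x > 0"
  shows "1 / (1 - exp (- x)) \<le> 1 + 1 / x"
proof -
  have "exp (- x) \<le> 1 / (1 + x)"
    using exp_ge_add_one_self[of x] assms by (simp add: exp_minus field_simps)
  hence "1 - exp (- x) \<ge> x / (1 + x)" using assms by (simp add: field_simps)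
  hence "1 / (1 - exp (- x)) \<le> 1 / (x / (1 + x))"
    using assms by (intro divide_left_mono mult_pos_pos) auto
  thus ?thesis using assms by (simp add: field_simps)
qed

context
  fixes k :: nat and Y \<alpha> :: real
  assumes k: "k \<ge> 1" and Y: "Y > 0" and \<alpha>: "0 < \<alpha>" "\<alpha> < 1"
begin

lemma norm_power_exp_sums:
  assumes "x > 0"
  shows "(\<lambda>m. cmod (power_exp k (of_real (Y * (real m + \<alpha>))) x)) sums
     (x ^ k * exp (- (Y * \<alpha> * x)) * (1 / (1 - exp (- (Y * x)))))"
proof -
  have "(\<lambda>m. x ^ k * exp (- (Y * \<alpha> * x)) * exp (- (Y * x)) ^ m) sums
     (x ^ k * exp (- (Y * \<alpha> * x)) * (1 / (1 - exp (- (Y * x)))))"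
    using assms Y by (intro sums_mult geometric_sums) auto
  moreover have "x ^ k * exp (- (Y * \<alpha> * x)) * exp (- (Y * x)) ^ m
     = cmod (power_exp k (of_real (Y * (real m + \<alpha>))) x)" for m
    using assms unfolding norm_power_exp
    by (simp add: exp_of_nat_mult[symmetric] mult.assoc exp_add[symmetric] algebra_simps)
  ultimately show ?thesis by simp
qed

lemma summable_norm_power_exp:
  assumes "x \<ge> 0"
  shows "summable (\<lambda>m. cmod (power_exp k (of_real (Y * (real m + \<alpha>))) x))"
proof (cases "x = 0")
  case True
  thus ?thesis using k by (simp add: power_exp_def power_0_left)
next
  case False
  thus ?thesis using norm_power_exp_sums[of x] assms by (auto simp: sums_iff)
qed

lemma norm_power_exp_sum_le:
  assumes "u \<in> {0..1}"
  shows "cmod (power_exp_sum k Y \<alpha> (real n + u)) \<le> (1 + 1 / Y) * ((real n + 1) ^ k * exp (- (Y * \<alpha> * real n)))"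
proof (cases "real n + u = 0")
  case True
  hence "power_exp_sum k Y \<alpha> (real n + u) = 0"
    using k by (simp add: power_exp_sum_def power_exp_def power_0_left)
  thus ?thesis using Y by simp
next
  case False
  define x where "x = real n + u"
  have x: "x > 0" "real n \<le> x" "x \<le> real n + 1" using False assms by (auto simp: x_def)
  have "cmod (power_exp_sum k Y \<alpha> x) \<le> (\<Sum>m. cmod (power_exp k (of_real (Y * (real m + \<alpha>))) x))"
    unfolding power_exp_sum_def using x by (intro summable_norm summable_norm_power_exp) auto
  also have "\<dots> = x ^ k * exp (- (Y * \<alpha> * x)) * (1 / (1 - exp (- (Y * x))))"
    using norm_power_exp_sums[OF x(1)] by (simp add: sums_iff)
  also have "\<dots> \<le> x ^ k * exp (- (Y * \<alpha> * x)) * (1 + 1 / (Y * x))"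
    using x Y by (intro mult_left_mono one_div_one_minus_exp_le) auto
  \<comment> \<open>The geometric series has a simple pole at x = 0. One factor of
    \<open>x ^ k\<close> cancels it, which is possible as \<open>k\<close> is at least 1.\<close>
  also have "\<dots> = x ^ (k - 1) * (x + 1 / Y) * exp (- (Y * \<alpha> * x))"
    using x Y k by (cases k) (auto simp: field_simps)
  also have "\<dots> \<le> (real n + 1) ^ (k - 1) * ((real n + 1) * (1 + 1 / Y)) * exp (- (Y * \<alpha> * real n))"
  proof (intro mult_mono power_mono)
    have "1 * (1 / Y) \<le> (real n + 1) * (1 / Y)" using Y by (intro mult_right_mono) auto
    thus "x + 1 / Y \<le> (real n + 1) * (1 + 1 / Y)"
      using x by (simp add: distrib_left)
  qed (use x Y \<alpha> in auto)
  also have "\<dots> = (1 + 1 / Y) * ((real n + 1) ^ k * exp (- (Y * \<alpha> * real n)))"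
    using k by (cases k) (auto simp: mult_ac)
  finally show ?thesis by (simp add: x_def)
qed

lemma summable_power_exp_sum_bound:
  "summable (\<lambda>n. (1 + 1 / Y) * ((real n + 1) ^ k * exp (- (Y * \<alpha> * real n))))"
  using Y \<alpha> by (intro summable_mult summable_power_mult_exp) auto

lemma summable_power_exp_sum:
  assumes "u \<in> {0..1}"
  shows "summable (\<lambda>n. power_exp_sum k Y \<alpha> (real n + u))"
  by (rule summable_comparison_test[OF _ summable_power_exp_sum_bound])
     (use norm_power_exp_sum_le[OF assms] in auto)

text \<open>Differentiation in \<open>u\<close> brings down a factor growing like m. In the term n =
  0 only the distance of \<open>u\<close> from 0 supplies decay in m, hence the restriction to u >=
  \<delta>. The inequality (m + \<alpha>)(n + \<delta>) >= \<delta> m + \<alpha> n splits the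
  exponential into a product, so the sums over m and n separate.\<close>

lemma power_exp_sum_local_lipschitz:
  assumes \<delta>: "0 < \<delta>"
  shows "\<exists>K. \<forall>u\<in>{\<delta>..1}. \<forall>v\<in>{\<delta>..1}.
    cmod ((\<Sum>n. power_exp_sum k Y \<alpha> (real n + u)) - (\<Sum>n. power_exp_sum k Y \<alpha> (real n + v))) \<le> K * \<bar>u - v\<bar>"
proof -
  define c where "c m = Y * (real m + \<alpha>)" for m
  define M where "M = (\<Sum>m. (real k + Y) * ((real m + 1) ^ 1 * exp (- (Y * \<delta> * real m))))"
  define N where "N = (\<Sum>n. (real n + 1) ^ k * exp (- (Y * \<alpha> * real n)))"
  have sM: "summable (\<lambda>m. (real k + Y) * ((real m + 1) ^ 1 * exp (- (Y * \<delta> * real m))))"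
    using Y \<delta> by (intro summable_mult summable_power_mult_exp) auto
  have sN: "summable (\<lambda>n. (real n + 1) ^ k * exp (- (Y * \<alpha> * real n)))"
    using Y \<alpha> by (intro summable_power_mult_exp) auto
  have termwise: "cmod (power_exp k (of_real (c m)) (real n + u) - power_exp k (of_real (c m)) (real n + v))
      \<le> (real k + Y) * ((real m + 1) ^ 1 * exp (- (Y * \<delta> * real m)))
          * (((real n + 1) ^ k * exp (- (Y * \<alpha> * real n))) * \<bar>u - v\<bar>)"
    if uv: "u \<in> {\<delta>..1}" "v \<in> {\<delta>..1}" for m n u v
  proof -
    have cpos: "c m > 0" using Y \<alpha> by (simp add: c_def add_nonneg_pos)
    have "cmod (power_exp k (of_real (c m)) (real n + u) - power_exp k (of_real (c m)) (real n + v))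
       \<le> (real k + cmod (of_real (c m))) * (real n + 1) ^ k * exp (- (Re (of_real (c m)) * (real n + \<delta>)))
           * \<bar>(real n + u) - (real n + v)\<bar>"
      using uv \<delta> cpos by (intro norm_power_exp_diff_le) auto
    also have "\<dots> = (real k + c m) * exp (- (c m * (real n + \<delta>))) * ((real n + 1) ^ k * \<bar>u - v\<bar>)"
      using cpos by simp
    also have "\<dots> \<le> ((real k + Y) * (real m + 1) * (exp (- (Y * \<delta> * real m)) * exp (- (Y * \<alpha> * real n))))
        * ((real n + 1) ^ k * \<bar>u - v\<bar>)"
    proof (intro mult_right_mono mult_mono)
      have "real k * 1 \<le> real k * (real m + 1)" by (intro mult_left_mono) auto
      moreover have "c m \<le> Y * (real m + 1)" unfolding c_def using Y \<alpha> by (intro mult_left_mono) auto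
      ultimately show "real k + c m \<le> (real k + Y) * (real m + 1)" by (simp add: distrib_right)
      have "Y * (\<delta> * real m + \<alpha> * real n) \<le> Y * ((real m + \<alpha>) * (real n + \<delta>))"
        using Y \<alpha> \<delta> by (intro mult_left_mono) (auto simp: algebra_simps)
      thus "exp (- (c m * (real n + \<delta>))) \<le> exp (- (Y * \<delta> * real m)) * exp (- (Y * \<alpha> * real n))"
        unfolding exp_add[symmetric] by (simp add: c_def algebra_simps)
    qed (use Y cpos in auto)
    finally show ?thesis by (simp add: mult_ac)
  qed
  have "cmod ((\<Sum>n. power_exp_sum k Y \<alpha> (real n + u)) - (\<Sum>n. power_exp_sum k Y \<alpha> (real n + v))) \<le> M * N * \<bar>u - v\<bar>"
    if uv: "u \<in> {\<delta>..1}" "v \<in> {\<delta>..1}" for u v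
  proof -
    have uv01: "u \<in> {0..1}" "v \<in> {0..1}" using uv \<delta> by auto
    have inner: "cmod (power_exp_sum k Y \<alpha> (real n + u) - power_exp_sum k Y \<alpha> (real n + v))
       \<le> M * (((real n + 1) ^ k * exp (- (Y * \<alpha> * real n))) * \<bar>u - v\<bar>)" for n
    proof -
      have eq: "power_exp_sum k Y \<alpha> (real n + u) - power_exp_sum k Y \<alpha> (real n + v)
         = (\<Sum>m. power_exp k (of_real (c m)) (real n + u) - power_exp k (of_real (c m)) (real n + v))"
        unfolding power_exp_sum_def c_def
        by (rule suminf_diff; rule summable_norm_cancel[OF summable_norm_power_exp]) (use uv01 in auto)
      have "cmod (\<Sum>m. power_exp k (of_real (c m)) (real n + u) - power_exp k (of_real (c m)) (real n + v))
         \<le> (\<Sum>m. (real k + Y) * ((real m + 1) ^ 1 * exp (- (Y * \<delta> * real m)))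
          * (((real n + 1) ^ k * exp (- (Y * \<alpha> * real n))) * \<bar>u - v\<bar>))"
        by (intro norm_suminf_le termwise uv summable_mult2[OF sM])
      also have "\<dots> = M * (((real n + 1) ^ k * exp (- (Y * \<alpha> * real n))) * \<bar>u - v\<bar>)"
        by (simp only: M_def suminf_mult2[OF sM])
      finally show ?thesis unfolding eq .
    qed
    have eq: "(\<Sum>n. power_exp_sum k Y \<alpha> (real n + u)) - (\<Sum>n. power_exp_sum k Y \<alpha> (real n + v))
       = (\<Sum>n. power_exp_sum k Y \<alpha> (real n + u) - power_exp_sum k Y \<alpha> (real n + v))"
      by (intro suminf_diff summable_power_exp_sum uv01)
    have "cmod (\<Sum>n. power_exp_sum k Y \<alpha> (real n + u) - power_exp_sum k Y \<alpha> (real n + v))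
        \<le> (\<Sum>n. M * (((real n + 1) ^ k * exp (- (Y * \<alpha> * real n))) * \<bar>u - v\<bar>))"
      by (intro norm_suminf_le inner summable_mult summable_mult2[OF sN])
    also have "\<dots> = M * (\<Sum>n. (real n + 1) ^ k * exp (- (Y * \<alpha> * real n)) * \<bar>u - v\<bar>)"
      by (rule suminf_mult[OF summable_mult2[OF sN]])
    also have "\<dots> = M * (N * \<bar>u - v\<bar>)"
      by (simp only: N_def suminf_mult2[OF sN])
    finally show ?thesis unfolding eq by (simp only: mult.assoc)
  qed
  thus ?thesis by blast
qed

lemma summable_shifted_power:
  "summable (\<lambda>m. fact k / (Y * (real m + \<alpha>)) ^ (k + 1))"
proof (rule summable_comparison_test)
  define K where "K = fact k / (Y * \<alpha>) ^ (k + 1)"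
  show "summable (\<lambda>m. K * inverse (real (Suc m) ^ (k + 1)))"
    using k by (intro summable_mult summable_Suc_iff[THEN iffD2] inverse_power_summable) auto
  have "fact k / (Y * (real m + \<alpha>)) ^ (k + 1) \<le> K * inverse (real (Suc m) ^ (k + 1))" for m
  proof -
    have "\<alpha> * real m \<le> real m" using \<alpha> by (simp add: mult_left_le_one_le)
    hence "Y * \<alpha> * real (Suc m) \<le> Y * (real m + \<alpha>)"
      using Y by (simp add: mult.assoc distrib_left)
    hence "(Y * \<alpha> * real (Suc m)) ^ (k + 1) \<le> (Y * (real m + \<alpha>)) ^ (k + 1)"
      using Y \<alpha> by (intro power_mono) auto
    hence "fact k / (Y * (real m + \<alpha>)) ^ (k + 1) \<le> fact k / (Y * \<alpha> * real (Suc m)) ^ (k + 1)"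
      using Y \<alpha> by (intro divide_left_mono mult_pos_pos zero_less_power) auto
    also have "\<dots> = K * inverse (real (Suc m) ^ (k + 1))"
      unfolding K_def power_mult_distrib[of "Y * \<alpha>"] by (simp only: divide_inverse inverse_mult_distrib mult.assoc)
    finally show ?thesis .
  qed
  thus "\<exists>N. \<forall>m\<ge>N. norm (fact k / (Y * (real m + \<alpha>)) ^ (k + 1)) \<le> K * inverse (real (Suc m) ^ (k + 1))"
    using Y \<alpha> by auto
qed

text \<open>Termwise integration. The frequency changes only the imaginary part of the exponent, so
  the integrals of the norms are the Laplace integrals at real parameter. They are summable over m
  because the exponent k + 1 is at least 2.\<close>

lemma set_integral_power_exp_sum:
  "(LINT u:{0..}|lborel. power_exp_sum k Y \<alpha> u * cis (- (2 * pi * of_int n * u))) = shifted_power_sum k Y \<alpha> n"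
proof -
  define z where "z m = of_real (Y * (real m + \<alpha>)) + \<i> * of_real (2 * pi * of_int n)" for m
  define f where "f m u = indicator {0..} u *\<^sub>R power_exp k (z m) u" for m u
  have Re_z: "Re (z m) = Y * (real m + \<alpha>)" for m by (simp add: z_def)
  have pos: "Y * (real m + \<alpha>) > 0" for m using Y \<alpha> by (simp add: add_nonneg_pos)
  have cpe: "cmod (power_exp k (z m) u) = cmod (power_exp k (of_real (Y * (real m + \<alpha>))) u)" for m u
    by (simp add: norm_power_exp Re_z)
  have f_int: "integrable lborel (f m)" for m
    using set_integrable_power_exp[of "z m" k] pos unfolding f_def set_integrable_def by (simp add: Re_z)
  have f_abs: "summable (\<lambda>m. cmod (f m u))" for u
    using summable_norm_power_exp[of u] by (cases "u \<ge> 0") (auto simp: f_def cpe)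
  have f_norm_int: "(LINT u|lborel. cmod (f m u)) = fact k / (Y * (real m + \<alpha>)) ^ (k + 1)" for m
  proof -
    have "complex_of_real (LINT u|lborel. cmod (f m u)) = (LINT u|lborel. complex_of_real (cmod (f m u)))"
      by (rule integral_complex_of_real[symmetric])
    also have "\<dots> = (LINT u:{0..}|lborel. power_exp k (of_real (Y * (real m + \<alpha>))) u)"
      unfolding set_lebesgue_integral_def
    proof (rule Bochner_Integration.integral_cong)
      fix u :: real
      show "complex_of_real (cmod (f m u)) = indicat_real {0..} u *\<^sub>R power_exp k (of_real (Y * (real m + \<alpha>))) u"
      proof (cases "u \<ge> 0")
        case True
        have "power_exp k (of_real (Y * (real m + \<alpha>))) u = of_real (u ^ k * exp (- (Y * (real m + \<alpha>) * u)))"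
          unfolding power_exp_def of_real_mult of_real_power exp_of_real[symmetric] by simp
        moreover have "cmod (f m u) = u ^ k * exp (- (Y * (real m + \<alpha>) * u))"
          using True by (simp add: f_def norm_power_exp Re_z)
        ultimately show ?thesis using True by simp
      qed (simp add: f_def)
    qed simp
    also have "\<dots> = of_real (fact k / (Y * (real m + \<alpha>)) ^ (k + 1))"
      using pos by (subst set_integral_power_exp) auto
    finally show ?thesis unfolding of_real_eq_iff .
  qed
  have "(LINT u:{0..}|lborel. power_exp_sum k Y \<alpha> u * cis (- (2 * pi * of_int n * u))) = (LINT u|lborel. (\<Sum>m. f m u))"
    unfolding set_lebesgue_integral_def
  proof (rule Bochner_Integration.integral_cong)
    fix u :: real
    show "indicat_real {0..} u *\<^sub>R (power_exp_sum k Y \<alpha> u * cis (- (2 * pi * of_int n * u))) = (\<Sum>m. f m u)"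
    proof (cases "u \<ge> 0")
      case True
      have "power_exp_sum k Y \<alpha> u * cis (- (2 * pi * of_int n * u))
         = (\<Sum>m. power_exp k (of_real (Y * (real m + \<alpha>))) u * cis (- (2 * pi * of_int n * u)))"
        unfolding power_exp_sum_def
        by (rule suminf_mult2[OF summable_norm_cancel[OF summable_norm_power_exp[OF True]]])
      thus ?thesis using True by (simp add: power_exp_mult_cis f_def z_def)
    qed (simp add: f_def)
  qed simp
  also have "\<dots> = (\<Sum>m. LINT u|lborel. f m u)"
    by (rule integral_suminf) (use f_int f_abs f_norm_int summable_shifted_power in auto)
  also have "(\<lambda>m. LINT u|lborel. f m u) = (\<lambda>m. fact k / z m ^ (k + 1))"
    using set_integral_power_exp[of "z _" k] pos
    by (simp add: fun_eq_iff f_def set_lebesgue_integral_def Re_z)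
  finally show ?thesis
    by (simp add: shifted_power_sum_def z_def mult_ac)
qed

lemma poisson_power_exp_sum:
  assumes \<psi>: "0 < \<psi>" "\<psi> < 1"
  shows "\<exists>A. (\<lambda>n. shifted_power_sum k Y \<alpha> (int n) * cis (2 * pi * of_int (int n) * \<psi>)) sums A \<and>
    (\<lambda>n. shifted_power_sum k Y \<alpha> (- int n - 1) * cis (2 * pi * of_int (- int n - 1) * \<psi>)) sums
      ((\<Sum>n. power_exp_sum k Y \<alpha> (real n + \<psi>)) - A)"
proof -
  define f where "f u = (\<Sum>n. power_exp_sum k Y \<alpha> (real n + u))" for u
  define B where "B = (\<Sum>n. (1 + 1 / Y) * ((real n + 1) ^ k * exp (- (Y * \<alpha> * real n))))"
  have B: "cmod (f u) \<le> B" if "u \<in> {0..1}" for u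
    unfolding f_def B_def by (intro norm_suminf_le norm_power_exp_sum_le that summable_power_exp_sum_bound)
  obtain K where "\<forall>u\<in>{\<psi>/2..1}. \<forall>v\<in>{\<psi>/2..1}. cmod (f u - f v) \<le> K * \<bar>u - v\<bar>"
    using power_exp_sum_local_lipschitz[of "\<psi> / 2"] \<psi> unfolding f_def by auto
  hence K: "cmod (f u - f v) \<le> K * \<bar>u - v\<bar>" if "u \<in> {\<psi>/2..1}" "v \<in> {\<psi>/2..1}" for u v
    using that by blast
  \<comment> \<open>Left of \<psi>/2 only boundedness is available. There the distance to \<psi> is
    at least \<psi>/2, so the trivial bound 2 B is at most 4 B / \<psi> times that distance.\<close>
  define K' where "K' = max K (4 * B / \<psi>)"
  \<comment> \<open>For \<open>u\<close> in the unit interval, \<eta> bounds 1 - |u - \<psi>| from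
    below, so the sine controls |u - \<psi>| up to the factor \<eta>.\<close>
  define \<eta> where "\<eta> = min \<psi> (1 - \<psi>)"
  have \<eta>: "\<eta> > 0" "\<eta> \<le> 1" using \<psi> by (auto simp: \<eta>_def)
  have "B \<ge> 0" using B[of 0] order_trans[OF norm_ge_zero] by simp
  hence K'0: "K' \<ge> 0" using \<psi> by (simp add: K'_def le_max_iff_disj)
  have lip: "cmod (f u - f \<psi>) \<le> K' * \<bar>u - \<psi>\<bar>" if u: "u \<in> {0..1}" for u
  proof (cases "u \<ge> \<psi> / 2")
    case True
    have "cmod (f u - f \<psi>) \<le> K * \<bar>u - \<psi>\<bar>" using True u \<psi> by (intro K) auto
    also have "\<dots> \<le> K' * \<bar>u - \<psi>\<bar>" by (intro mult_right_mono) (auto simp: K'_def)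
    finally show ?thesis .
  next
    case False
    have "cmod (f u - f \<psi>) \<le> cmod (f u) + cmod (f \<psi>)" by (rule norm_triangle_ineq4)
    also have "\<dots> \<le> 2 * B" using B[of u] B[of \<psi>] u \<psi> by simp
    also have "\<dots> = 4 * B / \<psi> * (\<psi> / 2)" using \<psi> by simp
    also have "\<dots> \<le> K' * \<bar>u - \<psi>\<bar>"
      using False \<psi> K'0 by (intro mult_mono) (auto simp: K'_def)
    finally show ?thesis .
  qed
  have "\<exists>A. (\<lambda>n. (LINT u:{0..}|lborel. power_exp_sum k Y \<alpha> u * cis (- (2 * pi * of_int (int n) * u)))
                 * cis (2 * pi * of_int (int n) * \<psi>)) sums A \<and>
    (\<lambda>n. (LINT u:{0..}|lborel. power_exp_sum k Y \<alpha> u * cis (- (2 * pi * of_int (- int n - 1) * u)))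
                 * cis (2 * pi * of_int (- int n - 1) * \<psi>)) sums (f \<psi> - A)"
  proof (rule poisson_summation_half_line[OF _ _ summable_power_exp_sum_bound])
    fix u :: real assume u: "u \<in> {0..1}"
    have "\<eta> * \<bar>u - \<psi>\<bar> \<le> min \<bar>u - \<psi>\<bar> (1 - \<bar>u - \<psi>\<bar>)"
    proof (rule min.boundedI)
      show "\<eta> * \<bar>u - \<psi>\<bar> \<le> \<bar>u - \<psi>\<bar>" using \<eta> by (simp add: mult_left_le_one_le)
      have "\<bar>u - \<psi>\<bar> \<le> 1" using u \<psi> by auto
      hence "\<eta> * \<bar>u - \<psi>\<bar> \<le> \<eta>" using \<eta> by (simp add: mult_left_le)
      also have "\<eta> \<le> 1 - \<bar>u - \<psi>\<bar>" using u \<psi> by (auto simp: \<eta>_def)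
      finally show "\<eta> * \<bar>u - \<psi>\<bar> \<le> 1 - \<bar>u - \<psi>\<bar>" .
    qed
    also have "\<dots> \<le> \<bar>sin (pi * (u - \<psi>))\<bar>"
      using u \<psi> by (intro sin_pi_ge_min) auto
    finally have "K' * \<bar>u - \<psi>\<bar> \<le> K' * (\<bar>sin (pi * (u - \<psi>))\<bar> / \<eta>)"
      using \<eta> K'0 by (intro mult_left_mono) (auto simp: field_simps)
    with lip[OF u] show "cmod ((\<Sum>n. power_exp_sum k Y \<alpha> (real n + u)) - f \<psi>) \<le> K' / \<eta> * \<bar>sin (pi * (u - \<psi>))\<bar>"
      by (simp add: f_def)
  qed (use norm_power_exp_sum_le in auto)
  thus ?thesis unfolding set_integral_power_exp_sum f_def .
qed

end

section \<open>The modular relation\<close>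

text \<open>The Poisson formulas at \<psi> and 1 - \<psi> carry conjugate characters. In their
  difference the frequency 0 and the unknown half sums \<open>A1\<close> and \<open>A2\<close>
  cancel, and conjugate characters combine into sines.\<close>

lemma power_exp_sum_reflection:
  fixes k :: nat and Y \<alpha> \<psi> :: real
  assumes k: "k \<ge> 1" and Y: "Y > 0" and \<alpha>: "0 < \<alpha>" "\<alpha> < 1" and \<psi>: "0 < \<psi>" "\<psi> < 1"
  defines "Z \<equiv> shifted_power_sum k Y \<alpha>"
  shows "(\<lambda>j. (Z (int (Suc j)) - Z (- int (Suc j))) * (2 * \<i> * of_real (sin (2 * pi * real (Suc j) * \<psi>)))) sums
     ((\<Sum>n. power_exp_sum k Y \<alpha> (real n + \<psi>)) - (\<Sum>n. power_exp_sum k Y \<alpha> (real n + (1 - \<psi>))))"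
proof -
  define E where "E j = cis (2 * pi * real (Suc j) * \<psi>)" for j
  define E' where "E' j = cis (- (2 * pi * real (Suc j) * \<psi>))" for j
  define f1 where "f1 = (\<Sum>n. power_exp_sum k Y \<alpha> (real n + \<psi>))"
  define f2 where "f2 = (\<Sum>n. power_exp_sum k Y \<alpha> (real n + (1 - \<psi>)))"
  have neg: "- int n - 1 = - int (Suc n)" for n by simp
  have refl: "cis (2 * pi * of_int m * (1 - \<psi>)) = cis (- (2 * pi * of_int m * \<psi>))" for m
  proof -
    have "cis (2 * pi * of_int m * (1 - \<psi>)) = cis (2 * pi * of_int m) * cis (- (2 * pi * of_int m * \<psi>))"
      unfolding cis_mult by (simp add: algebra_simps)
    thus ?thesis using cis_multiple_2pi[of "of_int m"] by simp
  qed
  have E_simps: "cis (2 * pi * of_int (int (Suc j)) * \<psi>) = E j"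
    "cis (2 * pi * of_int (- int (Suc j)) * \<psi>) = E' j"
    "cis (- (2 * pi * of_int (int (Suc j)) * \<psi>)) = E' j"
    "cis (- (2 * pi * of_int (- int (Suc j)) * \<psi>)) = E j" for j
    by (simp_all add: E_def E'_def algebra_simps)
  obtain A1 where A1: "(\<lambda>n. Z (int n) * cis (2 * pi * of_int (int n) * \<psi>)) sums A1"
    "(\<lambda>n. Z (- int (Suc n)) * E' n) sums (f1 - A1)"
    using poisson_power_exp_sum[OF k Y \<alpha> \<psi>] unfolding neg E_simps Z_def f1_def by blast
  obtain A2 where A2: "(\<lambda>n. Z (int n) * cis (- (2 * pi * of_int (int n) * \<psi>))) sums A2"
    "(\<lambda>n. Z (- int (Suc n)) * E n) sums (f2 - A2)"
    using poisson_power_exp_sum[OF k Y \<alpha>, of "1 - \<psi>"] \<psi> unfolding neg refl E_simps Z_def f2_def by auto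
  have B1: "(\<lambda>n. Z (int (Suc n)) * E n) sums (A1 - Z 0)"
    using A1(1) sums_Suc_iff[of "\<lambda>n. Z (int n) * cis (2 * pi * of_int (int n) * \<psi>)"]
    unfolding E_simps by simp
  have B2: "(\<lambda>n. Z (int (Suc n)) * E' n) sums (A2 - Z 0)"
    using A2(1) sums_Suc_iff[of "\<lambda>n. Z (int n) * cis (- (2 * pi * of_int (int n) * \<psi>))"]
    unfolding E_simps by simp
  have "(\<lambda>n. (Z (int (Suc n)) * E n + Z (- int (Suc n)) * E' n) - (Z (int (Suc n)) * E' n + Z (- int (Suc n)) * E n))
     sums ((A1 - Z 0 + (f1 - A1)) - (A2 - Z 0 + (f2 - A2)))"
    by (intro sums_add sums_diff B1 B2 A1 A2)
  moreover have "(Z (int (Suc n)) * E n + Z (- int (Suc n)) * E' n) - (Z (int (Suc n)) * E' n + Z (- int (Suc n)) * E n)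
     = (Z (int (Suc n)) - Z (- int (Suc n))) * (2 * \<i> * of_real (sin (2 * pi * real (Suc n) * \<psi>)))" for n
  proof -
    have "E n - E' n = 2 * \<i> * of_real (sin (2 * pi * real (Suc n) * \<psi>))"
      unfolding E_def E'_def by (simp add: complex_eq_iff)
    moreover have "(Z (int (Suc n)) * E n + Z (- int (Suc n)) * E' n) - (Z (int (Suc n)) * E' n + Z (- int (Suc n)) * E n)
       = (Z (int (Suc n)) - Z (- int (Suc n))) * (E n - E' n)"
      by (simp only: ring_distribs) simp
    ultimately show ?thesis by simp
  qed
  ultimately show ?thesis by (simp add: f1_def f2_def)
qed

text \<open>
  For odd \<open>k\<close> the second sum runs over the negative elements of the coset \<open>\<theta> + \<int>\<close>, so that
  Lipschitz summation over the whole coset applies.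
\<close>

lemma shifted_power_sum_pair:
  fixes k j :: nat and Y \<theta> :: real
  assumes k: "odd k" and Y: "Y > 0" and \<theta>: "0 < \<theta>" "\<theta> < 1" and j: "j \<ge> 1"
  shows "shifted_power_sum k Y \<theta> (int j) + shifted_power_sum k Y (1 - \<theta>) (- int j)
    = (2 * pi * \<i> / Y) ^ (k + 1) * (\<Sum>n. of_real (real n ^ k * exp (- (4 * pi\<^sup>2 / Y * real j * real n))) * cis (2 * pi * real n * \<theta>))"
proof -
  define w where "w = 2 * pi * \<i> / Y"
  \<comment> \<open>This is \<open>w\<close> times the base of the m = 0 term in the second sum: the
    factor \<open>w\<close> turns the step Y of the coset into 2 pi i and the imaginary offset -2 pi
    i j into the real part 4 pi^2 j / Y. That real part is positive exactly because j >= 1, as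
    Lipschitz summation requires.\<close>
  define z where "z = of_real (4 * pi\<^sup>2 / Y * real j) + 2 * pi * \<i> * of_real (1 - \<theta>)"
  have w0: "w \<noteq> 0" using Y by (simp add: w_def)
  have Re_z: "Re z > 0" using Y j by (simp add: z_def)
  obtain A where A: "(\<lambda>n. fact k / (z + 2 * pi * \<i> * of_nat n) ^ (k + 1)) sums A"
    "(\<lambda>n. fact k / (z - 2 * pi * \<i> * (of_nat n + 1)) ^ (k + 1)) sums
       ((\<Sum>n. of_nat n ^ k * exp (- (z * of_nat n))) - A)"
    using lipschitz_summation[OF Re_z, of k] odd_pos[OF k] by auto
  have lin1: "z + 2 * pi * \<i> * of_nat n = w * (of_real (Y * (real n + (1 - \<theta>))) + 2 * pi * \<i> * of_int (- int j))" for n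
    using Y by (simp add: z_def w_def field_simps power2_eq_square)
  have lin2: "z - 2 * pi * \<i> * (of_nat n + 1) = (- w) * (of_real (Y * (real n + \<theta>)) + 2 * pi * \<i> * of_int (int j))" for n
    using Y by (simp add: z_def w_def field_simps power2_eq_square)
  have scale: "fact k / (w * a) ^ (k + 1) * w ^ (k + 1) = fact k / a ^ (k + 1)" for a
    using w0 by (simp add: power_mult_distrib)
  have "(- w * a) ^ (k + 1) = (w * a) ^ (k + 1)" for a
    using k by (simp add: power_minus_even[of "k + 1"])
  hence scale': "fact k / (- w * a) ^ (k + 1) * w ^ (k + 1) = fact k / a ^ (k + 1)" for a
    by (simp only: scale)
  have "shifted_power_sum k Y (1 - \<theta>) (- int j) = A * w ^ (k + 1)"
    using sums_mult2[OF A(1), of "w ^ (k + 1)"]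
    unfolding lin1 scale shifted_power_sum_def by (rule sums_unique[symmetric])
  moreover have "shifted_power_sum k Y \<theta> (int j) = ((\<Sum>n. of_nat n ^ k * exp (- (z * of_nat n))) - A) * w ^ (k + 1)"
    using sums_mult2[OF A(2), of "w ^ (k + 1)"]
    unfolding lin2 scale' shifted_power_sum_def by (rule sums_unique[symmetric])
  moreover have "of_nat n ^ k * exp (- (z * of_nat n))
      = of_real (real n ^ k * exp (- (4 * pi\<^sup>2 / Y * real j * real n))) * cis (2 * pi * real n * \<theta>)" for n
  proof -
    have "- (z * of_nat n) = of_real (- (4 * pi\<^sup>2 / Y * real j * real n)) + \<i> * of_real (2 * pi * real n * \<theta>)
         + \<i> * of_real (2 * pi * of_int (- int n))"
      by (simp add: z_def algebra_simps)
    hence "exp (- (z * of_nat n)) = of_real (exp (- (4 * pi\<^sup>2 / Y * real j * real n))) * cis (2 * pi * real n * \<theta>)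
       * cis (2 * pi * of_int (- int n))"
      by (simp only: exp_add cis_conv_exp exp_of_real)
    also have "cis (2 * pi * of_int (- int n)) = 1"
      by (rule cis_multiple_2pi) (rule Ints_of_int)
    finally show ?thesis by simp
  qed
  ultimately show ?thesis by (simp add: w_def algebra_simps)
qed

text \<open>Iterated in the order in which Poisson summation delivers it, \<open>v\<close> inside
  and \<open>u\<close> outside. \<open>has_sum_double_power_exp_sum\<close> later identifies it with
  the unordered double sum.\<close>

definition double_power_exp_sum :: "nat \<Rightarrow> real \<Rightarrow> real \<Rightarrow> real \<Rightarrow> complex" where
  "double_power_exp_sum k Y \<alpha> \<beta> = (\<Sum>n. power_exp_sum k Y \<alpha> (real n + \<beta>))"

text \<open>Subtract the reflected Poisson formulas for \<theta> and 1 - \<theta> and regroup the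
  four half-cosets at each j into two full ones. Lipschitz summation evaluates both, and their
  phases are conjugate. Each difference of conjugate phases contributes 2 i times a sine, and the
  two factors 2 i give -4.\<close>

lemma dual_sum:
  fixes k :: nat and Y \<theta> \<psi> :: real
  assumes k: "odd k" and Y: "Y > 0" and \<theta>: "0 < \<theta>" "\<theta> < 1" and \<psi>: "0 < \<psi>" "\<psi> < 1"
  shows "(\<lambda>j. - 4 * (2 * pi * \<i> / Y) ^ (k + 1) * of_real (sin (2 * pi * real (Suc j) * \<psi>) *
       (\<Sum>n. real n ^ k * exp (- (4 * pi\<^sup>2 / Y * real (Suc j) * real n)) * sin (2 * pi * real n * \<theta>)))) sums
     (double_power_exp_sum k Y \<theta> \<psi> - double_power_exp_sum k Y \<theta> (1 - \<psi>)
       - (double_power_exp_sum k Y (1 - \<theta>) \<psi> - double_power_exp_sum k Y (1 - \<theta>) (1 - \<psi>)))"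
proof -
  define w where "w = 2 * pi * \<i> / Y"
  have k1: "k \<ge> 1" using odd_pos[OF k] by simp
  have \<theta>': "0 < 1 - \<theta>" "1 - \<theta> < 1" using \<theta> by auto
  define Z where "Z = shifted_power_sum k Y"
  define r where "r j n = real n ^ k * exp (- (4 * pi\<^sup>2 / Y * real j * real n))" for j n :: nat
  define S where "S j = (\<Sum>n. r j n * sin (2 * pi * real n * \<theta>))" for j
  have summ_r: "summable (r j)" if "j \<ge> 1" for j
  proof (rule summable_comparison_test)
    show "summable (\<lambda>n. (real n + 1) ^ k * exp (- (4 * pi\<^sup>2 / Y * real j * real n)))"
      using Y that by (intro summable_power_mult_exp) auto
    show "\<exists>N. \<forall>n\<ge>N. norm (r j n) \<le> (real n + 1) ^ k * exp (- (4 * pi\<^sup>2 / Y * real j * real n))"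
      unfolding r_def by (auto intro!: mult_right_mono power_mono)
  qed
  have summ_cis: "summable (\<lambda>n. of_real (r j n) * cis (2 * pi * real n * t))" if "j \<ge> 1" for j t
    by (rule summable_comparison_test[OF _ summ_r[OF that]]) (auto simp: norm_mult norm_power r_def)
  have summ_sin: "summable (\<lambda>n. r j n * sin (2 * pi * real n * \<theta>))" if "j \<ge> 1" for j
    by (rule summable_comparison_test[OF _ summ_r[OF that]])
       (auto simp: abs_mult r_def intro!: mult_left_le)
  have W: "Z \<theta> (int j) - Z \<theta> (- int j) - (Z (1 - \<theta>) (int j) - Z (1 - \<theta>) (- int j)) = w ^ (k + 1) * (2 * \<i> * of_real (S j))"
    if j: "j \<ge> 1" for j
  proof -
    have "Z \<theta> (int j) - Z \<theta> (- int j) - (Z (1 - \<theta>) (int j) - Z (1 - \<theta>) (- int j))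
       = (Z \<theta> (int j) + Z (1 - \<theta>) (- int j)) - (Z (1 - \<theta>) (int j) + Z (1 - (1 - \<theta>)) (- int j))"
      by simp
    also have "\<dots> = w ^ (k + 1) * (\<Sum>n. of_real (r j n) * cis (2 * pi * real n * \<theta>))
        - w ^ (k + 1) * (\<Sum>n. of_real (r j n) * cis (2 * pi * real n * (1 - \<theta>)))"
      unfolding Z_def w_def r_def
      by (simp only: shifted_power_sum_pair[OF k Y \<theta> j] shifted_power_sum_pair[OF k Y \<theta>' j])
    also have "\<dots> = w ^ (k + 1) * (\<Sum>n. of_real (r j n) * cis (2 * pi * real n * \<theta>) - of_real (r j n) * cis (2 * pi * real n * (1 - \<theta>)))"
      by (subst suminf_diff[OF summ_cis[OF j] summ_cis[OF j], symmetric]) (rule right_diff_distrib[symmetric])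
    also have "(\<lambda>n. of_real (r j n) * cis (2 * pi * real n * \<theta>) - of_real (r j n) * cis (2 * pi * real n * (1 - \<theta>)))
        = (\<lambda>n. 2 * \<i> * of_real (r j n * sin (2 * pi * real n * \<theta>)))"
    proof
      fix n
      have "cis (2 * pi * real n * (1 - \<theta>)) = cis (2 * pi * of_int (int n)) * cis (- (2 * pi * real n * \<theta>))"
        unfolding cis_mult by (simp add: algebra_simps)
      also have "cis (2 * pi * of_int (int n)) = 1" by (rule cis_multiple_2pi) (rule Ints_of_int)
      finally have "cis (2 * pi * real n * \<theta>) - cis (2 * pi * real n * (1 - \<theta>)) = 2 * \<i> * of_real (sin (2 * pi * real n * \<theta>))"
        by (simp add: complex_eq_iff)
      hence "of_real (r j n) * (cis (2 * pi * real n * \<theta>) - cis (2 * pi * real n * (1 - \<theta>))) = of_real (r j n) * (2 * \<i> * of_real (sin (2 * pi * real n * \<theta>)))"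
        by (simp only:)
      thus "of_real (r j n) * cis (2 * pi * real n * \<theta>) - of_real (r j n) * cis (2 * pi * real n * (1 - \<theta>))
         = 2 * \<i> * of_real (r j n * sin (2 * pi * real n * \<theta>))"
        by (simp only: right_diff_distrib of_real_mult mult_ac)
    qed
    also have "(\<Sum>n. 2 * \<i> * complex_of_real (r j n * sin (2 * pi * real n * \<theta>))) = 2 * \<i> * of_real (S j)"
      unfolding S_def using summ_sin[OF j] by (subst suminf_mult) (simp_all add: suminf_of_real summable_of_real del: of_real_mult)
    finally show ?thesis .
  qed
  have "(\<lambda>j. (Z \<theta> (int (Suc j)) - Z \<theta> (- int (Suc j))) * (2 * \<i> * of_real (sin (2 * pi * real (Suc j) * \<psi>)))
          - (Z (1 - \<theta>) (int (Suc j)) - Z (1 - \<theta>) (- int (Suc j))) * (2 * \<i> * of_real (sin (2 * pi * real (Suc j) * \<psi>)))) sums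
     (double_power_exp_sum k Y \<theta> \<psi> - double_power_exp_sum k Y \<theta> (1 - \<psi>)
       - (double_power_exp_sum k Y (1 - \<theta>) \<psi> - double_power_exp_sum k Y (1 - \<theta>) (1 - \<psi>)))"
    unfolding Z_def double_power_exp_sum_def
    by (intro sums_diff power_exp_sum_reflection k1 Y \<theta> \<theta>' \<psi>)
  also have "(\<lambda>j. (Z \<theta> (int (Suc j)) - Z \<theta> (- int (Suc j))) * (2 * \<i> * of_real (sin (2 * pi * real (Suc j) * \<psi>)))
          - (Z (1 - \<theta>) (int (Suc j)) - Z (1 - \<theta>) (- int (Suc j))) * (2 * \<i> * of_real (sin (2 * pi * real (Suc j) * \<psi>))))
     = (\<lambda>j. - 4 * w ^ (k + 1) * of_real (sin (2 * pi * real (Suc j) * \<psi>) * S (Suc j)))"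
  proof
    fix j
    show "(Z \<theta> (int (Suc j)) - Z \<theta> (- int (Suc j))) * (2 * \<i> * of_real (sin (2 * pi * real (Suc j) * \<psi>)))
          - (Z (1 - \<theta>) (int (Suc j)) - Z (1 - \<theta>) (- int (Suc j))) * (2 * \<i> * of_real (sin (2 * pi * real (Suc j) * \<psi>)))
       = - 4 * w ^ (k + 1) * of_real (sin (2 * pi * real (Suc j) * \<psi>) * S (Suc j))"
      unfolding left_diff_distrib[symmetric] by (subst W) (auto simp: algebra_simps)
  qed
  finally show ?thesis by (simp only: w_def S_def r_def)
qed

section \<open>Interchanging sums and integrals\<close>

lemma summable_on_prod_mult:
  fixes a b :: "nat \<Rightarrow> real"
  assumes "summable a" "summable b" "\<And>n. a n \<ge> 0" "\<And>n. b n \<ge> 0"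
  shows "(\<lambda>(m, n). a m * b n) summable_on UNIV"
proof -
  have a: "(a has_sum suminf a) UNIV" and b: "(b has_sum suminf b) UNIV"
    using assms by (auto intro!: sums_nonneg_imp_has_sum simp: summable_sums)
  have "(\<lambda>(m, n). a m * b n) summable_on (UNIV \<times> UNIV)"
  proof (rule summable_on_SigmaI)
    show "((\<lambda>n. case (m, n) of (m, n) \<Rightarrow> a m * b n) has_sum a m * suminf b) UNIV" for m
      using has_sum_cmult_right[OF b] by simp
    show "(\<lambda>m. a m * suminf b) summable_on UNIV"
      using has_sum_cmult_left[OF a] by (auto simp: summable_on_def)
  qed (use assms in auto)
  thus ?thesis by simp
qed

lemma has_sum_prod_inner:
  fixes f :: "nat \<times> nat \<Rightarrow> complex"
  assumes f: "(f has_sum S) UNIV"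
  shows "((\<lambda>n. \<Sum>m. f (m, n)) has_sum S) UNIV"
proof -
  have "(f has_sum S) (UNIV \<times> UNIV)" using f by simp
  hence sw: "((\<lambda>(n, m). f (m, n)) has_sum S) (UNIV \<times> UNIV)"
    by (rule has_sum_swap[THEN iffD1])
  hence "(\<lambda>(n, m). f (m, n)) summable_on (UNIV \<times> UNIV)"
    by (auto simp: summable_on_def)
  hence inner: "(\<lambda>m. f (m, n)) summable_on UNIV" for n
    by (rule summable_on_SigmaD1) simp
  have "((\<lambda>m. f (m, n)) has_sum (\<Sum>m. f (m, n))) UNIV" for n
    using has_sum_infsum[OF inner[of n]] has_sum_imp_sums[OF has_sum_infsum[OF inner[of n]]]
    by (simp add: sums_iff)
  thus ?thesis
    by (intro has_sum_SigmaD[OF sw]) simp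
qed

text \<open>Absolute convergence follows from (m + \<alpha>)(n + \<beta>) >= \<beta> m + \<alpha> n,
  which yields a product majorant.\<close>

lemma has_sum_double_power_exp_sum:
  fixes k :: nat and Y \<alpha> \<beta> :: real
  assumes Y: "Y > 0" and \<alpha>: "0 < \<alpha>" "\<alpha> < 1" and \<beta>: "0 < \<beta>" "\<beta> < 1"
  shows "((\<lambda>(m, n). power_exp k (of_real (Y * (real m + \<alpha>))) (real n + \<beta>)) has_sum
     double_power_exp_sum k Y \<alpha> \<beta>) UNIV"
proof -
  define f where "f = (\<lambda>(m, n). power_exp k (of_real (Y * (real m + \<alpha>))) (real n + \<beta>))"
  have summ: "(\<lambda>i. cmod (f i)) summable_on UNIV"
  proof (rule summable_on_comparison_test)
    \<comment> \<open>The power 0 presents the geometric series in m as an instance of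
      \<open>summable_power_mult_exp\<close>.\<close>
    show "(\<lambda>(m, n). ((real m + 1) ^ 0 * exp (- (Y * \<beta> * real m))) * ((real n + 1) ^ k * exp (- (Y * \<alpha> * real n)))) summable_on UNIV"
      using Y \<alpha> \<beta> by (intro summable_on_prod_mult summable_power_mult_exp) auto
    fix i :: "nat \<times> nat"
    obtain m n where i: "i = (m, n)" by (cases i)
    have "Y * (\<beta> * real m + \<alpha> * real n) \<le> Y * ((real m + \<alpha>) * (real n + \<beta>))"
      using Y \<alpha> \<beta> by (intro mult_left_mono) (auto simp: algebra_simps)
    hence "exp (- (Y * (real m + \<alpha>) * (real n + \<beta>))) \<le> exp (- (Y * \<beta> * real m)) * exp (- (Y * \<alpha> * real n))"
      unfolding exp_add[symmetric] by (simp add: algebra_simps)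
    hence "(real n + \<beta>) ^ k * exp (- (Y * (real m + \<alpha>) * (real n + \<beta>)))
       \<le> (real n + 1) ^ k * (exp (- (Y * \<beta> * real m)) * exp (- (Y * \<alpha> * real n)))"
      using \<beta> by (intro mult_mono power_mono) auto
    thus "cmod (f i) \<le> (case i of (m, n) \<Rightarrow> ((real m + 1) ^ 0 * exp (- (Y * \<beta> * real m))) * ((real n + 1) ^ k * exp (- (Y * \<alpha> * real n))))"
      using \<beta> by (simp add: i f_def norm_power_exp mult_ac)
  qed auto
  have "(f has_sum infsum f UNIV) UNIV"
    by (rule has_sum_infsum[OF abs_summable_summable[OF summ]])
  moreover from has_sum_imp_sums[OF has_sum_prod_inner[OF this]]
  have "infsum f UNIV = double_power_exp_sum k Y \<alpha> \<beta>"
    by (simp add: f_def power_exp_sum_def double_power_exp_sum_def sums_iff)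
  ultimately show ?thesis
    by (simp add: f_def)
qed

lemma set_integral_sums:
  fixes f :: "nat \<Rightarrow> real \<Rightarrow> complex"
  assumes int: "\<And>i. set_integrable lborel A (f i)"
    and sum: "summable (\<lambda>i. LINT t:A|lborel. cmod (f i t))"
    and pt: "\<And>t. t \<in> A \<Longrightarrow> summable (\<lambda>i. cmod (f i t))"
  shows "set_integrable lborel A (\<lambda>t. \<Sum>i. f i t)"
    and "(\<lambda>i. LINT t:A|lborel. f i t) sums (LINT t:A|lborel. (\<Sum>i. f i t))"
    and "summable (\<lambda>i. cmod (LINT t:A|lborel. f i t))"
proof -
  define F where "F i t = indicator A t *\<^sub>R f i t" for i t
  have F_int: "integrable lborel (F i)" for i
    using int[of i] by (simp add: F_def[abs_def] set_integrable_def)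
  have F_pt: "summable (\<lambda>i. cmod (F i t))" for t
    using pt[of t] by (cases "t \<in> A") (auto simp: F_def)
  have norm_eq: "(LINT t:A|lborel. cmod (f i t)) = (LINT t|lborel. cmod (F i t))" for i
    by (simp add: F_def set_lebesgue_integral_def)
  have F_sum: "summable (\<lambda>i. LINT t|lborel. cmod (F i t))"
    using sum unfolding norm_eq .
  have F_suminf: "(\<Sum>i. F i t) = indicator A t *\<^sub>R (\<Sum>i. f i t)" for t
    by (cases "t \<in> A") (auto simp: F_def)
  show "set_integrable lborel A (\<lambda>t. \<Sum>i. f i t)"
    unfolding set_integrable_def F_suminf[symmetric]
    by (rule integrable_suminf) (use F_int F_pt F_sum in auto)
  have "(\<lambda>i. LINT t|lborel. F i t) sums (LINT t|lborel. (\<Sum>i. F i t))"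
    by (rule sums_integral) (use F_int F_pt F_sum in auto)
  thus "(\<lambda>i. LINT t:A|lborel. f i t) sums (LINT t:A|lborel. (\<Sum>i. f i t))"
    unfolding F_suminf by (simp add: set_lebesgue_integral_def F_def)
  show "summable (\<lambda>i. cmod (LINT t:A|lborel. f i t))"
  proof (rule summable_comparison_test[OF _ sum], intro exI allI impI)
    show "norm (cmod (LINT t:A|lborel. f i t)) \<le> (LINT t:A|lborel. cmod (f i t))" for i
      using set_integral_norm_bound[OF int[of i]] by simp
  qed
qed

text \<open>Enumerating the pairs by \<open>prod_decode\<close> reduces this to a series. Absolute
  summability of the integrals, the third part of \<open>set_integral_sums\<close>, then restores
  unordered summation.\<close>

lemma set_integral_has_sum_prod:
  fixes f :: "nat \<times> nat \<Rightarrow> real \<Rightarrow> complex"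
  assumes int: "\<And>i. set_integrable lborel A (f i)"
    and sum: "(\<lambda>i. LINT t:A|lborel. cmod (f i t)) summable_on UNIV"
    and pt: "\<And>t. t \<in> A \<Longrightarrow> (\<lambda>i. cmod (f i t)) summable_on UNIV"
    and F: "\<And>t. t \<in> A \<Longrightarrow> ((\<lambda>i. f i t) has_sum F t) UNIV"
  shows "set_integrable lborel A F"
    and "((\<lambda>i. LINT t:A|lborel. f i t) has_sum (LINT t:A|lborel. F t)) UNIV"
proof -
  have bij: "bij_betw prod_decode UNIV UNIV" by (rule bij_prod_decode)
  have sum': "summable (\<lambda>j. LINT t:A|lborel. cmod (f (prod_decode j) t))"
    using sum summable_on_reindex_bij_betw[OF bij, of "\<lambda>i. LINT t:A|lborel. cmod (f i t)"]
    by (auto intro: summable_on_imp_summable)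
  have pt': "summable (\<lambda>j. cmod (f (prod_decode j) t))" if "t \<in> A" for t
    using pt[OF that] summable_on_reindex_bij_betw[OF bij, of "\<lambda>i. cmod (f i t)"]
    by (auto intro: summable_on_imp_summable)
  have F': "(\<Sum>j. f (prod_decode j) t) = F t" if "t \<in> A" for t
    using F[OF that] has_sum_reindex_bij_betw[OF bij, of "\<lambda>i. f i t"]
    by (metis has_sum_imp_sums sums_unique)
  note * = set_integral_sums[of A "\<lambda>j. f (prod_decode j)", OF int sum' pt']
  have cong: "indicator A t *\<^sub>R (\<Sum>j. f (prod_decode j) t) = indicator A t *\<^sub>R F t" for t
    using F' by (cases "t \<in> A") auto
  show "set_integrable lborel A F"
    using *(1) unfolding set_integrable_def cong .
  have "(\<lambda>j. LINT t:A|lborel. f (prod_decode j) t) sums (LINT t:A|lborel. F t)"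
    using *(2) unfolding set_lebesgue_integral_def cong .
  hence "((\<lambda>j. LINT t:A|lborel. f (prod_decode j) t) has_sum (LINT t:A|lborel. F t)) UNIV"
    using *(3) by (intro norm_summable_imp_has_sum)
  thus "((\<lambda>i. LINT t:A|lborel. f i t) has_sum (LINT t:A|lborel. F t)) UNIV"
    using has_sum_reindex_bij_betw[OF bij, of "\<lambda>i. LINT t:A|lborel. f i t"] by simp
qed

text \<open>Pairs are grouped by their product: (d, e) corresponds to (d e, d). Starting at 1 keeps
  every fibre a finite set of divisors.\<close>

lemma has_sum_divisors:
  fixes h :: "nat \<times> nat \<Rightarrow> complex"
  assumes h: "(h has_sum S) ({1..} \<times> {1..})"
  shows "((\<lambda>n. \<Sum>d | d dvd n. h (d, n div d)) has_sum S) {1..}"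
proof -
  have "((\<lambda>(n, d). h (d, n div d)) has_sum S) (SIGMA n:{1..}. {d. d dvd n})"
  proof (rule has_sum_reindex_bij_witness[THEN iffD1, OF _ _ _ _ _ refl h])
    show "(\<lambda>(d, e). (d * e, d)) ((\<lambda>(n, d). (d, n div d)) b) = b"
      "(\<lambda>(n, d). (d, n div d)) b \<in> {1..} \<times> {1..}" if b_in: "b \<in> (SIGMA n:{1..}. {d. d dvd n})" for b :: "nat \<times> nat"
    proof -
      obtain n d where b: "b = (n, d)" and n: "n \<ge> 1" and "d dvd n" using b_in by auto
      then obtain e where e: "n = d * e" by auto
      have "d \<ge> 1" using n e by (cases d) auto
      moreover have "e \<ge> 1" using n e by (cases e) auto
      ultimately show "(\<lambda>(d, e). (d * e, d)) ((\<lambda>(n, d). (d, n div d)) b) = b"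
        "(\<lambda>(n, d). (d, n div d)) b \<in> {1..} \<times> {1..}"
        unfolding b e by auto
    qed
  qed (auto simp: Suc_le_eq)
  thus ?thesis
    by (rule has_sum_SigmaD) (auto simp: finite_divisors_nat)
qed

lemma has_sum_atLeast1_imp_sums:
  assumes "(f has_sum S) {1::nat..}"
  shows "(\<lambda>j. f (Suc j)) sums S"
proof -
  have "bij_betw Suc UNIV {1..}"
    by (rule bij_betwI[of _ _ _ "\<lambda>n. n - 1"]) auto
  from has_sum_reindex_bij_betw[OF this, of f S] assms show ?thesis
    by (auto intro: has_sum_imp_sums)
qed

section \<open>Gamma and Bessel integrals\<close>

text \<open>For t > 0 this is t^(s-1) e^(-t). Written with \<open>exp\<close> and the real
  \<open>ln\<close>, its norm, its shifts in \<open>s\<close> and its scaling all come from the laws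
  of the exponential.\<close>

definition gamma_kernel :: "complex \<Rightarrow> real \<Rightarrow> complex" where
  "gamma_kernel s t = exp ((s - 1) * of_real (ln t)) * of_real (exp (- t))"

lemma borel_measurable_gamma_kernel [measurable]: "gamma_kernel s \<in> borel_measurable borel"
proof -
  have [measurable]: "(exp :: complex \<Rightarrow> complex) \<in> borel_measurable borel"
    by (intro borel_measurable_continuous_onI continuous_intros)
  show ?thesis unfolding gamma_kernel_def by measurable
qed

text \<open>Integrals of norms can thus be evaluated by the same complex formulas, taken at
  \<open>Re s\<close>.\<close>

lemma norm_gamma_kernel_eq: "of_real (cmod (gamma_kernel s t)) = gamma_kernel (of_real (Re s)) t"
  by (simp add: gamma_kernel_def norm_mult exp_of_real[symmetric])

lemma gamma_kernel_shift:
  assumes "t > 0"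
  shows "gamma_kernel (s + of_nat n) t = of_real (t ^ n) * gamma_kernel s t"
proof -
  have "exp (of_nat n * of_real (ln t)) = complex_of_real (t ^ n)"
    using assms by (simp add: exp_of_nat_mult exp_of_real)
  moreover have "(s + of_nat n - 1) * complex_of_real (ln t) = of_nat n * of_real (ln t) + (s - 1) * of_real (ln t)"
    by (simp add: algebra_simps)
  ultimately show ?thesis by (simp add: gamma_kernel_def exp_add)
qed

lemma gamma_kernel_integral:
  assumes s: "Re s > 0"
  shows "set_integrable lborel {0<..} (gamma_kernel s)"
    and "(LINT t:{0<..}|lborel. gamma_kernel s t) = Gamma s"
proof -
  have eq: "gamma_kernel s t = of_real t powr (s - 1) / of_real (exp t)" if "t > 0" for t
    using that by (simp add: gamma_kernel_def powr_def exp_minus field_simps Ln_of_real)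
  have "set_integrable lebesgue {0<..} (\<lambda>t. of_real t powr (s - 1) / of_real (exp t))"
    using s by (rule absolutely_integrable_Gamma_integral')
  also have "?this \<longleftrightarrow> set_integrable lebesgue {0<..} (gamma_kernel s)"
    by (rule set_integrable_cong) (simp_all add: eq)
  also have "\<dots> \<longleftrightarrow> set_integrable lborel {0<..} (gamma_kernel s)"
    unfolding set_integrable_def by (rule integrable_completion) measurable
  finally show *: "set_integrable lborel {0<..} (gamma_kernel s)" .
  have "(LINT t:{0<..}|lborel. gamma_kernel s t) = integral {0<..} (gamma_kernel s)"
    by (rule set_borel_integral_eq_integral(2)[OF *])
  also have "\<dots> = integral {0<..} (\<lambda>t. of_real t powr (s - 1) / of_real (exp t))"
    by (rule Henstock_Kurzweil_Integration.integral_cong) (simp add: eq)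
  also have "\<dots> = Gamma s"
    using Gamma_integral_complex'[OF s] by (rule integral_unique)
  finally show "(LINT t:{0<..}|lborel. gamma_kernel s t) = Gamma s" .
qed

text \<open>Scaling of the Gamma integral by b = c + 1: the kernel contributes b^(s-1), the constant
  \<open>r\<close> of the proof, and the substitution one more factor b.\<close>

lemma gamma_kernel_exp_integral:
  assumes s: "Re s > 0" and c: "c \<ge> 0"
  shows "set_integrable lborel {0<..} (\<lambda>t. gamma_kernel s t * of_real (exp (- (c * t))))"
    and "(LINT t:{0<..}|lborel. gamma_kernel s t * of_real (exp (- (c * t)))) = Gamma s / of_real (c + 1) powr s"
proof -
  define b where "b = c + 1"
  have b: "b > 0" using c by (simp add: b_def)
  define f where "f t = indicator {0<..} t *\<^sub>R gamma_kernel s t" for t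
  define r where "r = exp ((s - 1) * of_real (ln b))"
  have r: "r \<noteq> 0" by (simp add: r_def)
  have eq: "f (0 + b * t) = r * (indicator {0<..} t *\<^sub>R (gamma_kernel s t * of_real (exp (- (c * t)))))" for t
  proof (cases "t > 0")
    case True
    have "(s - 1) * of_real (ln (b * t)) = (s - 1) * of_real (ln b) + (s - 1) * of_real (ln t)"
      using True b by (simp add: ln_mult algebra_simps)
    moreover have "exp (- (b * t)) = exp (- t) * exp (- (c * t))"
      by (simp add: b_def exp_add[symmetric] algebra_simps)
    ultimately show ?thesis using True b
      by (simp add: f_def gamma_kernel_def r_def exp_add)
  next
    case False
    thus ?thesis using b by (simp add: f_def zero_less_mult_iff)
  qed
  have f_int: "integrable lborel f"
    using gamma_kernel_integral(1)[OF s] by (simp add: f_def[abs_def] set_integrable_def)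
  have "integrable lborel (\<lambda>t. f (0 + b * t))"
    using b by (intro lborel_integrable_real_affine f_int) auto
  hence "integrable lborel (\<lambda>t. inverse r * f (0 + b * t))"
    by (rule integrable_mult_right)
  thus "set_integrable lborel {0<..} (\<lambda>t. gamma_kernel s t * of_real (exp (- (c * t))))"
    unfolding set_integrable_def eq using r by (simp add: mult.assoc[symmetric])
  have "Gamma s = (LINT t|lborel. f t)"
    using gamma_kernel_integral(2)[OF s] by (simp add: f_def[abs_def] set_lebesgue_integral_def)
  also have "\<dots> = \<bar>b\<bar> *\<^sub>R (LINT t|lborel. f (0 + b * t))"
    using b by (intro lborel_integral_real_affine) auto
  also have "\<dots> = of_real b * r * (LINT t:{0<..}|lborel. gamma_kernel s t * of_real (exp (- (c * t))))"
    unfolding eq set_lebesgue_integral_def using b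
    by (subst integral_mult_right_zero) (simp add: scaleR_conv_of_real)
  also have "of_real b * r = of_real b powr s"
  proof -
    have "of_real b * r = exp (of_real (ln b)) * exp ((s - 1) * of_real (ln b))"
      using b by (simp add: r_def exp_of_real)
    also have "\<dots> = of_real b powr s"
      using b by (simp add: exp_add[symmetric] powr_def Ln_of_real algebra_simps)
    finally show ?thesis .
  qed
  finally have "Gamma s = of_real b powr s * (LINT t:{0<..}|lborel. gamma_kernel s t * of_real (exp (- (c * t))))" .
  thus "(LINT t:{0<..}|lborel. gamma_kernel s t * of_real (exp (- (c * t)))) = Gamma s / of_real (c + 1) powr s"
    using b by (simp add: b_def[symmetric])
qed

text \<open>The substitution t = sqrt w e^s gives t + w/t = 2 sqrt w cosh s and t^(\<nu>-1) dt =
  w^(\<nu>/2) e^(\<nu> s) ds. Folding the real line at 0 replaces e^(\<nu> s) by 2 cosh (\<nu> s),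
  which is the defining integral. Integrability comes from the Gamma kernel, as e^(-w/t) is at most
  1.\<close>

lemma besselK_integral:
  assumes \<nu>: "Re \<nu> > 0" and w: "w > 0"
  shows "set_integrable lborel {0<..} (\<lambda>t. gamma_kernel \<nu> t * of_real (exp (- (w / t))))"
    and "(LINT t:{0<..}|lborel. gamma_kernel \<nu> t * of_real (exp (- (w / t))))
       = 2 * of_real w powr (\<nu> / 2) * besselK \<nu> (2 * sqrt w)"
proof -
  define h where "h t = gamma_kernel \<nu> t * of_real (exp (- (w / t)))" for t
  have h_meas [measurable]: "h \<in> borel_measurable borel" unfolding h_def by measurable
  show int: "set_integrable lborel {0<..} (\<lambda>t. gamma_kernel \<nu> t * of_real (exp (- (w / t))))"
  proof (rule set_integrable_bound[OF gamma_kernel_integral(1)[OF \<nu>]])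
    show "set_borel_measurable lborel {0<..} (\<lambda>t. gamma_kernel \<nu> t * of_real (exp (- (w / t))))"
      unfolding set_borel_measurable_def by measurable
    show "AE t in lborel. t \<in> {0<..} \<longrightarrow> cmod (gamma_kernel \<nu> t * of_real (exp (- (w / t)))) \<le> cmod (gamma_kernel \<nu> t)"
      using w by (intro AE_I2) (auto simp: norm_mult intro!: mult_left_le)
  qed
  define I where "I = integral {0<..} h"
  define z where "z = 2 * sqrt w"
  define \<phi> where "\<phi> s = complex_of_real (exp (- z * cosh s)) * exp (\<nu> * of_real s)" for s
  define r where "r = exp (\<nu> * of_real (ln (sqrt w)))"
  have h_abs: "h absolutely_integrable_on {0<..}"
    using int unfolding h_def[abs_def] set_integrable_def
    by (subst integrable_completion) measurable
  define g where "g s = sqrt w * exp s" for s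
  have g_img: "g ` UNIV = {0<..}"
  proof safe
    fix t :: real assume "t > 0"
    hence "t = g (ln (t / sqrt w))" using w by (simp add: g_def)
    thus "t \<in> range g" by blast
  qed (use w in \<open>simp add: g_def\<close>)
  have subst: "\<bar>sqrt w * exp s\<bar> *\<^sub>R h (g s) = r * \<phi> s" for s
  proof -
    have ln_g: "ln (g s) = ln (sqrt w) + s" using w by (simp add: g_def ln_mult)
    have "w / g s = sqrt w * exp (- s)"
      using w by (simp add: g_def exp_minus field_simps)
    hence e: "exp (- g s) * exp (- (w / g s)) = exp (- z * cosh s)"
      unfolding exp_add[symmetric] by (simp add: g_def z_def cosh_def field_simps)
    have "complex_of_real (sqrt w * exp s) = exp (of_real (ln (g s)))"
      using w by (simp add: g_def exp_of_real)
    hence "complex_of_real (sqrt w * exp s) * exp ((\<nu> - 1) * of_real (ln (g s))) = exp (\<nu> * of_real (ln (g s)))"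
      by (simp add: exp_add[symmetric] algebra_simps)
    also have "\<dots> = r * exp (\<nu> * of_real s)"
      by (simp add: ln_g r_def exp_add[symmetric] algebra_simps)
    finally have p: "complex_of_real (sqrt w * exp s) * exp ((\<nu> - 1) * of_real (ln (g s))) = r * exp (\<nu> * of_real s)" .
    have "\<bar>sqrt w * exp s\<bar> *\<^sub>R h (g s) = complex_of_real (sqrt w * exp s) * exp ((\<nu> - 1) * of_real (ln (g s)))
        * of_real (exp (- g s) * exp (- (w / g s)))"
      using w by (simp add: h_def gamma_kernel_def scaleR_conv_of_real)
    also have "\<dots> = r * \<phi> s"
      unfolding p e \<phi>_def by simp
    finally show ?thesis .
  qed
  have "(\<lambda>s. \<bar>sqrt w * exp s\<bar> *\<^sub>R h (g s)) absolutely_integrable_on UNIV \<and> integral UNIV (\<lambda>s. \<bar>sqrt w * exp s\<bar> *\<^sub>R h (g s)) = I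
      \<longleftrightarrow> h absolutely_integrable_on g ` UNIV \<and> integral (g ` UNIV) h = I"
    using w by (intro has_absolute_integral_change_of_variables_real)
       (auto simp: g_def inj_on_def intro!: derivative_eq_intros)
  hence r\<phi>: "(\<lambda>s. r * \<phi> s) absolutely_integrable_on UNIV" "integral UNIV (\<lambda>s. r * \<phi> s) = I"
    unfolding g_img subst using h_abs by (auto simp: I_def)
  have r0: "r \<noteq> 0" by (simp add: r_def)
  have \<phi>: "\<phi> absolutely_integrable_on UNIV"
    using set_integrable_mult_right[OF r\<phi>(1), of "inverse r"] r0 by (simp add: mult.assoc[symmetric])
  have \<phi>A: "\<phi> absolutely_integrable_on A" if "A \<in> sets lebesgue" for A
    using \<phi> that by (rule set_integrable_subset) auto
  have \<phi>_int: "\<phi> integrable_on A" if "A \<in> sets lebesgue" for A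
    using \<phi>A[OF that] by (rule set_lebesgue_integral_eq_integral(1))
  have neg: "(\<lambda>s. \<bar>-1\<bar> *\<^sub>R \<phi> (- s)) absolutely_integrable_on {0..} \<and> integral {0..} (\<lambda>s. \<bar>-1\<bar> *\<^sub>R \<phi> (- s)) = integral {..0} \<phi>
      \<longleftrightarrow> \<phi> absolutely_integrable_on uminus ` {0..} \<and> integral (uminus ` {0..}) \<phi> = integral {..0} \<phi>"
    by (intro has_absolute_integral_change_of_variables_real)
       (auto simp: inj_on_def intro!: derivative_eq_intros)
  have "uminus ` {0..} = {..0::real}"
    by (auto simp: image_iff intro!: bexI[of _ "- _"])
  hence neg': "(\<lambda>s. \<phi> (- s)) absolutely_integrable_on {0..}" "integral {0..} (\<lambda>s. \<phi> (- s)) = integral {..0} \<phi>"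
    using neg \<phi>A[of "{..0}"] by auto
  have "integral UNIV \<phi> = integral ({0..} \<union> {..0}) \<phi>"
    by (rule arg_cong2[of _ _ _ _ integral]) auto
  also have "\<dots> = integral {0..} \<phi> + integral {..0} \<phi>"
  proof (rule integral_Un)
    have "{0..} \<inter> {..0::real} = {0}" by auto
    thus "negligible ({0..} \<inter> {..0::real})" by simp
  qed (auto intro: \<phi>_int)
  also have "\<dots> = integral {0..} (\<lambda>s. \<phi> s + \<phi> (- s))"
    unfolding neg'(2)[symmetric]
    using \<phi>_int[of "{0..}"] set_lebesgue_integral_eq_integral(1)[OF neg'(1)]
    by (subst Henstock_Kurzweil_Integration.integral_add) auto
  also have "(\<lambda>s. \<phi> s + \<phi> (- s)) = (\<lambda>s. 2 * (complex_of_real (exp (- z * cosh s)) * cosh (\<nu> * of_real s)))"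
    by (rule ext) (simp add: \<phi>_def cosh_def scaleR_conv_of_real algebra_simps)
  also have "integral {0..} \<dots> = 2 * besselK \<nu> z"
    by (simp only: besselK_def integral_mult_right)
  finally have "integral UNIV \<phi> = 2 * besselK \<nu> z" .
  hence "I = r * (2 * besselK \<nu> z)"
    using r\<phi>(2) by simp
  moreover have "r = of_real w powr (\<nu> / 2)"
    using w by (simp add: r_def powr_def Ln_of_real ln_sqrt)
  moreover have "(LINT t:{0<..}|lborel. h t) = I"
    unfolding I_def using int by (intro set_borel_integral_eq_integral(2)) (simp add: h_def[abs_def])
  ultimately show "(LINT t:{0<..}|lborel. gamma_kernel \<nu> t * of_real (exp (- (w / t))))
       = 2 * of_real w powr (\<nu> / 2) * besselK \<nu> (2 * sqrt w)"
    by (simp add: h_def z_def mult_ac)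
qed

section \<open>Divisor sums and Mellin integrals\<close>

definition divisor_sine_sum :: "nat \<Rightarrow> real \<Rightarrow> real \<Rightarrow> nat \<Rightarrow> real" where
  "divisor_sine_sum k \<theta> \<psi> n
     = (\<Sum>d | d dvd n. real d ^ k * sin (2 * pi * real d * \<theta>) * sin (2 * pi * real n * \<psi> / real d))"

text \<open>Polynomial growth suffices, since the exponential in the Bessel integral can be traded
  for any power of n.\<close>

lemma abs_divisor_sine_sum_le:
  assumes "n \<ge> 1"
  shows "\<bar>divisor_sine_sum k \<theta> \<psi> n\<bar> \<le> real n ^ (k + 1)"
proof -
  have "\<bar>divisor_sine_sum k \<theta> \<psi> n\<bar> \<le> (\<Sum>d | d dvd n. real n ^ k)"
    unfolding divisor_sine_sum_def
  proof (rule order_trans[OF sum_abs], rule sum_mono)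
    fix d assume "d \<in> {d. d dvd n}"
    hence "d \<le> n" using assms by (auto intro: dvd_imp_le)
    hence "real d ^ k \<le> real n ^ k" by (intro power_mono) auto
    moreover have "\<bar>real d ^ k * sin (2 * pi * real d * \<theta>) * sin (2 * pi * real n * \<psi> / real d)\<bar> \<le> real d ^ k * 1 * 1"
      unfolding abs_mult by (intro mult_mono) auto
    ultimately show "\<bar>real d ^ k * sin (2 * pi * real d * \<theta>) * sin (2 * pi * real n * \<psi> / real d)\<bar> \<le> real n ^ k"
      by linarith
  qed
  also have "\<dots> = real (card {d. d dvd n}) * real n ^ k" by simp
  also have "card {d. d dvd n} \<le> card {1..n}"
    using assms by (intro card_mono) (auto intro: dvd_imp_le Suc_leI Nat.gr0I)
  hence "real (card {d. d dvd n}) * real n ^ k \<le> real n * real n ^ k"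
    by (intro mult_right_mono) auto
  finally show ?thesis by simp
qed

text \<open>One absolutely convergent double sum over d, e >= 1 is evaluated twice: row by row it is
  the series of \<open>dual_sum\<close>, and grouped by n = d e it is the divisor series. The
  majorant is a product because d e >= (d + e)/2.\<close>

lemma dual_sum_divisors:
  fixes k :: nat and Y \<theta> \<psi> :: real
  assumes k: "odd k" and Y: "Y > 0" and \<theta>: "0 < \<theta>" "\<theta> < 1" and \<psi>: "0 < \<psi>" "\<psi> < 1"
  defines "y \<equiv> 4 * pi\<^sup>2 / Y"
  shows "double_power_exp_sum k Y \<theta> \<psi> - double_power_exp_sum k Y \<theta> (1 - \<psi>)
       - (double_power_exp_sum k Y (1 - \<theta>) \<psi> - double_power_exp_sum k Y (1 - \<theta>) (1 - \<psi>))
     = - 4 * (2 * pi * \<i> / Y) ^ (k + 1) *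
       (\<Sum>j. of_real (divisor_sine_sum k \<theta> \<psi> (Suc j) * exp (- (y * real (Suc j)))))"
proof -
  have y: "y > 0" using Y by (simp add: y_def)
  define h :: "nat \<times> nat \<Rightarrow> complex" where
    "h = (\<lambda>(d, e). of_real (real d ^ k * exp (- (y * real e * real d)) * sin (2 * pi * real d * \<theta>) * sin (2 * pi * real e * \<psi>)))"
  have "(\<lambda>i. cmod (h i)) summable_on ({1..} \<times> {1..})"
  proof (rule summable_on_comparison_test)
    have "(\<lambda>(m, n). ((real m + 1) ^ k * exp (- (y / 2 * real m))) * ((real n + 1) ^ 0 * exp (- (y / 2 * real n)))) summable_on UNIV"
      using y by (intro summable_on_prod_mult summable_power_mult_exp) auto
    thus "(\<lambda>(m, n). ((real m + 1) ^ k * exp (- (y / 2 * real m))) * ((real n + 1) ^ 0 * exp (- (y / 2 * real n)))) summable_on ({1..} \<times> {1..})"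
      by (rule summable_on_subset_banach) auto
    fix i :: "nat \<times> nat" assume "i \<in> {1..} \<times> {1..}"
    then obtain d e where i: "i = (d, e)" and de: "d \<ge> 1" "e \<ge> 1" by auto
    have "real d \<le> real d * real e" "real e \<le> real d * real e" using de by auto
    hence "real d / 2 + real e / 2 \<le> real e * real d" by (simp add: mult.commute)
    hence "y * (real d / 2 + real e / 2) \<le> y * (real e * real d)"
      using y by (intro mult_left_mono) auto
    hence E: "exp (- (y * real e * real d)) \<le> exp (- (y / 2 * real d)) * exp (- (y / 2 * real e))"
      unfolding exp_add[symmetric] by (simp add: algebra_simps)
    have "cmod (h i) = real d ^ k * exp (- (y * real e * real d)) * \<bar>sin (2 * pi * real d * \<theta>)\<bar> * \<bar>sin (2 * pi * real e * \<psi>)\<bar>"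
      by (simp add: i h_def norm_mult norm_power)
    also have "\<dots> \<le> real d ^ k * exp (- (y * real e * real d)) * 1 * 1"
      by (intro mult_mono) auto
    also have "\<dots> \<le> (real d + 1) ^ k * (exp (- (y / 2 * real d)) * exp (- (y / 2 * real e)))"
      using E by (auto intro!: mult_mono power_mono)
    finally show "cmod (h i) \<le> (case i of (m, n) \<Rightarrow> ((real m + 1) ^ k * exp (- (y / 2 * real m))) * ((real n + 1) ^ 0 * exp (- (y / 2 * real n))))"
      by (simp add: i mult_ac)
  qed auto
  from has_sum_infsum[OF abs_summable_summable[OF this]]
  obtain S where S: "(h has_sum S) ({1..} \<times> {1..})" by blast
  have "(\<lambda>j. \<Sum>d | d dvd Suc j. h (d, Suc j div d)) sums S"
    by (rule has_sum_atLeast1_imp_sums[OF has_sum_divisors[OF S]])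
  moreover have "(\<Sum>d | d dvd n. h (d, n div d)) = of_real (divisor_sine_sum k \<theta> \<psi> n * exp (- (y * real n)))"
    if "n \<ge> 1" for n
  proof -
    have "h (d, n div d) = of_real (real d ^ k * sin (2 * pi * real d * \<theta>) * sin (2 * pi * real n * \<psi> / real d) * exp (- (y * real n)))"
      if "d dvd n" for d
    proof -
      have "real (n div d) = real n / real d" using that by (rule real_of_nat_div)
      moreover have "real (n div d) * real d = real n" using that by (simp flip: of_nat_mult)
      ultimately show ?thesis by (simp add: h_def mult_ac times_divide_eq_right)
    qed
    thus ?thesis unfolding divisor_sine_sum_def sum_distrib_right of_real_sum by (intro sum.cong) auto
  qed
  ultimately have X: "(\<lambda>j. of_real (divisor_sine_sum k \<theta> \<psi> (Suc j) * exp (- (y * real (Suc j))))) sums S"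
    by simp
  define g where "g e = (\<Sum>d. real d ^ k * exp (- (y * real e * real d)) * sin (2 * pi * real d * \<theta>))" for e :: nat
  have sw: "((\<lambda>(e, d). h (d, e)) has_sum S) ({1..} \<times> {1..})"
    using S by (rule has_sum_swap[THEN iffD1])
  have "((\<lambda>e. of_real (sin (2 * pi * real e * \<psi>) * g e)) has_sum S) {1..}"
  proof (rule has_sum_SigmaD[OF sw])
    fix e :: nat assume e: "e \<in> {1..}"
    define f where "f d = real d ^ k * exp (- (y * real e * real d)) * sin (2 * pi * real d * \<theta>)" for d :: nat
    have "summable (\<lambda>d. \<bar>f d\<bar>)"
    proof (rule summable_comparison_test)
      show "summable (\<lambda>n. (real n + 1) ^ k * exp (- (y * real e * real n)))"
        using y e by (intro summable_power_mult_exp) auto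
      have "\<bar>f n\<bar> \<le> (real n + 1) ^ k * exp (- (y * real e * real n)) * 1" for n
        unfolding f_def abs_mult by (intro mult_mono) (auto intro!: power_mono)
      thus "\<exists>N. \<forall>n\<ge>N. norm \<bar>f n\<bar> \<le> (real n + 1) ^ k * exp (- (y * real e * real n))" by auto
    qed
    hence "(f has_sum g e) UNIV"
      by (intro norm_summable_imp_has_sum)
         (auto simp: g_def f_def[symmetric] summable_sums summable_rabs_cancel)
    \<comment> \<open>The inner series of \<open>dual_sum\<close> starts at d = 0, where its term
      vanishes.\<close>
    hence "(f has_sum g e) {1..}"
      using odd_pos[OF k] by (subst has_sum_cong_neutral[where T = UNIV and g = f]) (auto simp: f_def not_le)
    hence "((\<lambda>d. of_real (sin (2 * pi * real e * \<psi>) * f d)) has_sum complex_of_real (sin (2 * pi * real e * \<psi>) * g e)) {1..}"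
      by (intro has_sum_of_real has_sum_cmult_right)
    thus "((\<lambda>d. case (e, d) of (e, d) \<Rightarrow> h (d, e)) has_sum of_real (sin (2 * pi * real e * \<psi>) * g e)) {1..}"
      by (simp add: h_def f_def mult_ac)
  qed
  from sums_mult[OF has_sum_atLeast1_imp_sums[OF this], of "- 4 * (2 * pi * \<i> / Y) ^ (k + 1)"]
  have "(\<lambda>j. - 4 * (2 * pi * \<i> / Y) ^ (k + 1) * of_real (sin (2 * pi * real (Suc j) * \<psi>) *
       (\<Sum>n. real n ^ k * exp (- (4 * pi\<^sup>2 / Y * real (Suc j) * real n)) * sin (2 * pi * real n * \<theta>))))
     sums (- 4 * (2 * pi * \<i> / Y) ^ (k + 1) * S)"
    unfolding g_def y_def .
  from sums_unique2[OF dual_sum[OF k Y \<theta> \<psi>] this] sums_unique[OF X]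
  show ?thesis by simp
qed

lemma summable_shifted_powr:
  fixes \<alpha> p :: real
  assumes "0 < \<alpha>" "\<alpha> < 1" "p > 1"
  shows "summable (\<lambda>n. (real n + \<alpha>) powr (- p))"
proof (rule summable_comparison_test)
  show "summable (\<lambda>n. \<alpha> powr (- p) * real (Suc n) powr (- p))"
    using assms by (intro summable_mult summable_Suc_iff[THEN iffD2]) (simp add: summable_real_powr_iff)
  have "(real n + \<alpha>) powr (- p) \<le> \<alpha> powr (- p) * real (Suc n) powr (- p)" for n
  proof -
    have "\<alpha> * real n \<le> real n" using assms by (simp add: mult_left_le_one_le)
    hence "\<alpha> * real (Suc n) \<le> real n + \<alpha>" by (simp add: algebra_simps)
    hence "(real n + \<alpha>) powr (- p) \<le> (\<alpha> * real (Suc n)) powr (- p)"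
      using assms by (intro powr_mono2') auto
    thus ?thesis using assms by (simp add: powr_mult)
  qed
  thus "\<exists>N. \<forall>n\<ge>N. norm ((real n + \<alpha>) powr (- p)) \<le> \<alpha> powr (- p) * real (Suc n) powr (- p)"
    by auto
qed

text \<open>With u = n + \<beta> and v = m + \<alpha>, each term integrates to Gamma(s) u^k / (c u v
  + 1)^s. Dropping the 1 bounds the absolute integrals by a multiple of u^(-(Re \<nu> + 1)) v^(-(Re
  \<nu> + k + 1)), and Re \<nu> > 0 makes both exponents summable.\<close>

lemma mellin_double_power_exp_sum:
  fixes k :: nat and c \<alpha> \<beta> :: real and \<nu> :: complex
  assumes c: "c > 0" and \<alpha>: "0 < \<alpha>" "\<alpha> < 1" and \<beta>: "0 < \<beta>" "\<beta> < 1" and \<nu>: "Re \<nu> > 0"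
  defines "s \<equiv> \<nu> + of_nat k + 1"
  shows "set_integrable lborel {0<..} (\<lambda>t. gamma_kernel s t * double_power_exp_sum k (c * t) \<alpha> \<beta>)"
    and "((\<lambda>(m, n). Gamma s * (of_real ((real n + \<beta>) ^ k) / of_real (c * ((real n + \<beta>) * (real m + \<alpha>)) + 1) powr s))
       has_sum (LINT t:{0<..}|lborel. gamma_kernel s t * double_power_exp_sum k (c * t) \<alpha> \<beta>)) UNIV"
proof -
  have s: "Re s > 0" using \<nu> by (simp add: s_def)
  define C where "C = (\<lambda>(m, n). c * ((real n + \<beta>) * (real m + \<alpha>)))"
  define P where "P = (\<lambda>(m::nat, n). (real n + \<beta>) ^ k)"
  have C: "C i > 0" for i using c \<alpha> \<beta> by (cases i) (simp add: C_def add_nonneg_pos)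
  have P: "P i > 0" for i using \<beta> by (cases i) (simp add: P_def add_nonneg_pos)
  define f where "f i t = of_real (P i) * (gamma_kernel s t * of_real (exp (- (C i * t))))" for i t
  have f_eq: "f i t = gamma_kernel s t * (case i of (m, n) \<Rightarrow> power_exp k (of_real (c * t * (real m + \<alpha>))) (real n + \<beta>))" for i t
    by (cases i) (simp add: f_def P_def C_def power_exp_def exp_of_real[symmetric] mult_ac)
  have f_int: "set_integrable lborel {0<..} (f i)" for i
    unfolding f_def using gamma_kernel_exp_integral(1)[OF s less_imp_le[OF C]] by (intro set_integrable_mult_right)
  have f_val: "(LINT t:{0<..}|lborel. f i t) = Gamma s * (of_real (P i) / of_real (C i + 1) powr s)" for i
    unfolding f_def set_integral_mult_right gamma_kernel_exp_integral(2)[OF s less_imp_le[OF C]] by simp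
  have \<Gamma>: "Gamma (Re s) > 0" using s by (rule Gamma_real_pos)
  have f_norm: "(LINT t:{0<..}|lborel. cmod (f i t)) = P i * Gamma (Re s) / (C i + 1) powr Re s" for i
  proof -
    have "complex_of_real (LINT t:{0<..}|lborel. cmod (f i t)) = (LINT t:{0<..}|lborel. complex_of_real (cmod (f i t)))"
      by (rule set_integral_complex_of_real[symmetric])
    also have "(\<lambda>t. complex_of_real (cmod (f i t))) = (\<lambda>t. of_real (P i) * (gamma_kernel (of_real (Re s)) t * of_real (exp (- (C i * t)))))"
      using P[of i] by (simp add: f_def norm_mult norm_gamma_kernel_eq fun_eq_iff)
    also have "(LINT t:{0<..}|lborel. \<dots> t) = of_real (P i) * (Gamma (of_real (Re s)) / of_real (C i + 1) powr of_real (Re s))"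
      unfolding set_integral_mult_right using gamma_kernel_exp_integral(2)[of "of_real (Re s)" "C i"] s C[of i] by simp
    also have "Gamma (complex_of_real (Re s)) / complex_of_real (C i + 1) powr complex_of_real (Re s)
        = complex_of_real (Gamma (Re s) / (C i + 1) powr Re s)"
      using C[of i] by (simp only: Gamma_complex_of_real powr_of_real of_real_divide less_imp_le add_nonneg_nonneg zero_le_one)
    finally have "complex_of_real (LINT t:{0<..}|lborel. cmod (f i t)) = complex_of_real (P i * (Gamma (Re s) / (C i + 1) powr Re s))"
      by (simp only: of_real_mult)
    thus ?thesis unfolding of_real_eq_iff by simp
  qed
  have f_sum: "(\<lambda>i. LINT t:{0<..}|lborel. cmod (f i t)) summable_on UNIV"
    unfolding f_norm
  proof (rule summable_on_comparison_test)
    have "(\<lambda>(m, n). (real m + \<alpha>) powr (- (Re \<nu> + real k + 1)) * (real n + \<beta>) powr (- (Re \<nu> + 1))) summable_on UNIV"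
      using \<nu> \<alpha> \<beta> by (intro summable_on_prod_mult summable_shifted_powr) auto
    thus "(\<lambda>i. Gamma (Re s) * c powr (- Re s) * (case i of (m, n) \<Rightarrow> (real m + \<alpha>) powr (- (Re \<nu> + real k + 1)) * (real n + \<beta>) powr (- (Re \<nu> + 1)))) summable_on UNIV"
      by (intro summable_on_cmult_right)
    fix i :: "nat \<times> nat"
    obtain m n where i: "i = (m, n)" by (cases i)
    define u v where "u = real n + \<beta>" and "v = real m + \<alpha>"
    have uv: "u > 0" "v > 0" using \<alpha> \<beta> by (auto simp: u_def v_def add_nonneg_pos)
    have "u ^ k * (C i + 1) powr (- Re s) \<le> u ^ k * (C i) powr (- Re s)"
      using C[of i] s uv by (intro mult_left_mono powr_mono2') auto
    also have "C i powr (- Re s) = c powr (- Re s) * (u powr (- Re s) * v powr (- Re s))"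
      using uv c by (simp add: C_def i u_def v_def powr_mult)
    also have "u powr (- Re s) = u powr (- (Re \<nu> + 1)) * u powr (- real k)"
      by (simp add: s_def powr_add[symmetric] algebra_simps)
    also have "u powr (- real k) = inverse (u ^ k)"
      using uv by (simp add: powr_minus powr_realpow)
    also have "u ^ k * (c powr (- Re s) * (u powr (- (Re \<nu> + 1)) * inverse (u ^ k) * v powr (- Re s)))
       = c powr (- Re s) * (v powr (- Re s) * u powr (- (Re \<nu> + 1)))"
      using uv by simp
    finally have "Gamma (Re s) * (u ^ k * (C i + 1) powr (- Re s)) \<le> Gamma (Re s) * (c powr (- Re s) * (v powr (- Re s) * u powr (- (Re \<nu> + 1))))"
      using \<Gamma> by (intro mult_left_mono) auto
    thus "P i * Gamma (Re s) / (C i + 1) powr Re s \<le> Gamma (Re s) * c powr (- Re s) * (case i of (m, n) \<Rightarrow> (real m + \<alpha>) powr (- (Re \<nu> + real k + 1)) * (real n + \<beta>) powr (- (Re \<nu> + 1)))"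
      unfolding powr_minus[of "C i + 1"]
      by (simp add: i P_def u_def v_def s_def divide_inverse mult_ac)
    show "0 \<le> P i * Gamma (Re s) / (C i + 1) powr Re s"
      using P[of i] \<Gamma> by simp
  qed
  have f_pt: "(\<lambda>i. cmod (f i t)) summable_on UNIV"
    and f_has: "((\<lambda>i. f i t) has_sum gamma_kernel s t * double_power_exp_sum k (c * t) \<alpha> \<beta>) UNIV" if "t \<in> {0<..}" for t
  proof -
    have ct: "c * t > 0" using c that by simp
    show "((\<lambda>i. f i t) has_sum gamma_kernel s t * double_power_exp_sum k (c * t) \<alpha> \<beta>) UNIV"
      unfolding f_eq
      by (intro has_sum_cmult_right has_sum_double_power_exp_sum ct \<alpha> \<beta>)
    hence "(\<lambda>i. f i t) summable_on UNIV" by (auto simp: summable_on_def)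
    thus "(\<lambda>i. cmod (f i t)) summable_on UNIV"
      by (subst summable_on_iff_abs_summable_on_complex[symmetric])
  qed
  show "set_integrable lborel {0<..} (\<lambda>t. gamma_kernel s t * double_power_exp_sum k (c * t) \<alpha> \<beta>)"
    by (rule set_integral_has_sum_prod(1)[OF f_int f_sum f_pt f_has])
  have "((\<lambda>i. LINT t:{0<..}|lborel. f i t) has_sum
      (LINT t:{0<..}|lborel. gamma_kernel s t * double_power_exp_sum k (c * t) \<alpha> \<beta>)) UNIV"
    by (rule set_integral_has_sum_prod(2)[OF f_int f_sum f_pt f_has])
  thus "((\<lambda>(m, n). Gamma s * (of_real ((real n + \<beta>) ^ k) / of_real (c * ((real n + \<beta>) * (real m + \<alpha>)) + 1) powr s))
       has_sum (LINT t:{0<..}|lborel. gamma_kernel s t * double_power_exp_sum k (c * t) \<alpha> \<beta>)) UNIV"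
    unfolding f_val P_def C_def by (simp add: case_prod_unfold)
qed

lemma besselK_divisor_series:
  fixes k :: nat and q \<theta> \<psi> :: real and \<nu> :: complex
  assumes q: "q > 0" and \<nu>: "Re \<nu> > 0"
  shows "(\<lambda>j. of_real (divisor_sine_sum k \<theta> \<psi> (Suc j)) * (2 * of_real (q * real (Suc j)) powr (\<nu> / 2) * besselK \<nu> (2 * sqrt (q * real (Suc j)))))
    sums (LINT t:{0<..}|lborel. gamma_kernel \<nu> t * (\<Sum>j. of_real (divisor_sine_sum k \<theta> \<psi> (Suc j) * exp (- (q / t * real (Suc j))))))"
proof -
  define \<sigma> where "\<sigma> j = divisor_sine_sum k \<theta> \<psi> (Suc j)" for j
  define w where "w j = q * real (Suc j)" for j
  have w: "w j > 0" for j using q by (simp add: w_def)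
  define f where "f j t = of_real (\<sigma> j) * (gamma_kernel \<nu> t * of_real (exp (- (w j / t))))" for j t
  \<comment> \<open>With w = q n, the bound e^(-w/t) <= (k + 3)! (t/w)^(k+3) turns the growth
    n^(k+1) of the coefficients into 1/n^2. The price t^(k+3) only shifts the Gamma kernel to \<nu>
    + k + 3, which is integrable.\<close>
  define K where "K = fact (k + 3) / q ^ (k + 3)"
  define G where "G t = cmod (gamma_kernel (\<nu> + of_nat (k + 3)) t)" for t
  have G_int: "set_integrable lborel {0<..} G"
    using gamma_kernel_integral(1)[of "\<nu> + of_nat (k + 3)"] \<nu> unfolding G_def by (intro set_integrable_norm) auto
  have f_int: "set_integrable lborel {0<..} (f j)" for j
    unfolding f_def using besselK_integral(1)[OF \<nu> w] by (intro set_integrable_mult_right)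
  have f_val: "(LINT t:{0<..}|lborel. f j t) = of_real (\<sigma> j) * (2 * of_real (w j) powr (\<nu> / 2) * besselK \<nu> (2 * sqrt (w j)))" for j
    unfolding f_def set_integral_mult_right besselK_integral(2)[OF \<nu> w] ..
  have bound: "cmod (f j t) \<le> K * inverse (real (Suc j) ^ 2) * G t" if t: "t > 0" for j t
  proof -
    define n where "n = real (Suc j)"
    have n: "n > 0" by (simp add: n_def)
    have "(w j / t) ^ (k + 3) \<le> fact (k + 3) * exp (w j / t)"
      using w[of j] t by (intro power_div_fact_le_exp) (auto intro: less_imp_le)
    hence "exp (- (w j / t)) \<le> fact (k + 3) / (w j / t) ^ (k + 3)"
      using w[of j] t by (simp add: exp_minus field_simps)
    also have "\<dots> = K * t ^ (k + 3) * inverse (n ^ (k + 3))"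
    proof -
      have "w j = q * n" by (simp add: w_def n_def)
      thus ?thesis by (simp only: K_def power_divide power_mult_distrib) (simp add: field_simps)
    qed
    finally have e: "exp (- (w j / t)) \<le> K * t ^ (k + 3) * inverse (n ^ (k + 3))" .
    have "cmod (f j t) = \<bar>\<sigma> j\<bar> * (cmod (gamma_kernel \<nu> t) * exp (- (w j / t)))"
      by (simp add: f_def norm_mult)
    also have "\<dots> \<le> n ^ (k + 1) * (cmod (gamma_kernel \<nu> t) * (K * t ^ (k + 3) * inverse (n ^ (k + 3))))"
      using abs_divisor_sine_sum_le[of "Suc j" k \<theta> \<psi>] e n
      by (intro mult_mono) (auto simp: \<sigma>_def n_def)
    also have "\<dots> = K * (n ^ (k + 1) * inverse (n ^ (k + 3))) * (t ^ (k + 3) * cmod (gamma_kernel \<nu> t))"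
      by (simp only: mult_ac)
    also have "n ^ (k + 1) * inverse (n ^ (k + 3)) = inverse (n ^ 2)"
    proof -
      have "k + 3 = (k + 1) + 2" by simp
      hence "n ^ (k + 3) = n ^ (k + 1) * n ^ 2" by (simp only: power_add)
      hence "n ^ (k + 1) * inverse (n ^ (k + 3)) = n ^ (k + 1) * inverse (n ^ (k + 1)) * inverse (n ^ 2)"
        by (simp only: inverse_mult_distrib mult.assoc)
      moreover have "n ^ (k + 1) * inverse (n ^ (k + 1)) = 1" using n by (intro right_inverse) simp
      ultimately show ?thesis by (simp only: mult_1_left)
    qed
    also have "t ^ (k + 3) * cmod (gamma_kernel \<nu> t) = G t"
      unfolding G_def gamma_kernel_shift[OF t] using t by (simp add: norm_mult norm_power)
    finally show ?thesis by (simp add: n_def)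
  qed
  have sumK: "summable (\<lambda>j. K * inverse (real (Suc j) ^ 2) * b)" for b
    by (intro summable_mult summable_mult2 summable_Suc_iff[THEN iffD2] inverse_power_summable) auto
  have f_sum: "summable (\<lambda>j. LINT t:{0<..}|lborel. cmod (f j t))"
  proof (rule summable_comparison_test[OF _ sumK[of "LINT t:{0<..}|lborel. G t"]], intro exI allI impI)
    fix j
    have "(LINT t:{0<..}|lborel. cmod (f j t)) \<le> (LINT t:{0<..}|lborel. K * inverse (real (Suc j) ^ 2) * G t)"
      using bound by (intro set_integral_mono set_integrable_norm f_int set_integrable_mult_right G_int) auto
    also have "\<dots> = K * inverse (real (Suc j) ^ 2) * (LINT t:{0<..}|lborel. G t)"
      by (rule set_integral_mult_right)
    finally show "norm (LINT t:{0<..}|lborel. cmod (f j t)) \<le> K * inverse (real (Suc j) ^ 2) * (LINT t:{0<..}|lborel. G t)"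
      by (subst real_norm_def, subst abs_of_nonneg) (auto simp: set_lebesgue_integral_def)
  qed
  have f_pt: "summable (\<lambda>j. cmod (f j t))" if "t \<in> {0<..}" for t
    by (rule summable_comparison_test[OF _ sumK[of "G t"]]) (use bound[of t] that in auto)
  have "(\<lambda>j. LINT t:{0<..}|lborel. f j t) sums (LINT t:{0<..}|lborel. (\<Sum>j. f j t))"
    by (rule set_integral_sums(2)[OF f_int f_sum f_pt])
  also have "(LINT t:{0<..}|lborel. (\<Sum>j. f j t)) = (LINT t:{0<..}|lborel. gamma_kernel \<nu> t * (\<Sum>j. of_real (\<sigma> j * exp (- (q / t * real (Suc j))))))"
  proof (rule set_lebesgue_integral_cong, safe)
    fix t :: real assume t: "t > 0"
    have eq: "f j t = gamma_kernel \<nu> t * of_real (\<sigma> j * exp (- (q / t * real (Suc j))))" for j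
      by (simp add: f_def w_def mult_ac)
    have "gamma_kernel \<nu> t \<noteq> 0" by (simp add: gamma_kernel_def)
    thus "(\<Sum>j. f j t) = gamma_kernel \<nu> t * (\<Sum>j. of_real (\<sigma> j * exp (- (q / t * real (Suc j)))))"
      using f_pt[of t] t unfolding eq
      by (intro suminf_mult) (simp add: norm_mult summable_cmult_iff summable_norm_cancel)
  qed simp
  finally show ?thesis unfolding f_val \<sigma>_def w_def .
qed

section \<open>The identity, by matching the two Mellin integrals\<close>

theorem theorem2p12:
  fixes a x \<theta> \<psi> :: real and k :: nat and \<nu> :: complex
  assumes "a > 0" and "x > 0" and "0 < \<theta>" and "\<theta> < 1" and "0 < \<psi>" and "\<psi> < 1"
    and "k \<ge> 1" and "odd k" and "Re \<nu> > 0"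
  defines "T \<equiv> \<lambda>u v::real. complex_of_real (u ^ k) /
              complex_of_real ((16 * pi\<^sup>2 / a\<^sup>2) * (u * v) / x + 1) powr (\<nu> + of_nat k + 1)"
  defines "g \<equiv> \<lambda>(m::nat, n::nat).
              T (real n + \<psi>) (real m + \<theta>) - T (real n + 1 - \<psi>) (real m + \<theta>)
            - T (real n + \<psi>) (real m + 1 - \<theta>) + T (real n + 1 - \<psi>) (real m + 1 - \<theta>)"
  shows "g summable_on UNIV \<and>
    (\<lambda>j. let n = Suc j in
        complex_of_real (a\<^sup>2 * x / 4) powr (\<nu> / 2 + of_nat k + 1)
        * (of_nat n powr (\<nu> / 2)) * besselK \<nu> (a * sqrt (real n * x))
        * complex_of_real (\<Sum>d | d dvd n. real d ^ k * sin (2 * pi * real d * \<theta>)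
                                        * sin (2 * pi * real n * \<psi> / real d)))
     sums
      (- ((-1) ^ ((k + 1) div 2) / (8 * complex_of_real ((2 * pi) powr (- real k - 1))))
        * Gamma (\<nu> + of_nat k + 1) * infsum g UNIV)"
proof -
  define s where "s = \<nu> + of_nat k + 1"
  \<comment> \<open>The product of \<open>c\<close> and \<open>q\<close> is 4 pi^2. Hence Y = c t on
    the right side corresponds under Y -> 4 pi^2 / Y to y = q / t, the variable of the Bessel
    side.\<close>
  define c where "c = 16 * pi\<^sup>2 / a\<^sup>2 / x"
  define q where "q = a\<^sup>2 * x / 4"
  have c: "c > 0" and q: "q > 0" using assms(1,2) by (simp_all add: c_def q_def)
  have cq: "4 * pi\<^sup>2 / c = q" using assms(1,2) by (simp add: c_def q_def field_simps)
  note \<theta> = assms(3,4) and \<psi> = assms(5,6) and \<nu> = assms(9)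
  have \<theta>': "0 < 1 - \<theta>" "1 - \<theta> < 1" and \<psi>': "0 < 1 - \<psi>" "1 - \<psi> < 1" using \<theta> \<psi> by auto
  have "Re s > 0" using \<nu> by (simp add: s_def)
  hence \<Gamma>: "Gamma s \<noteq> 0" by (auto simp: Gamma_eq_zero_iff elim!: nonpos_Ints_cases)
  define D where "D \<alpha> \<beta> Y = double_power_exp_sum k Y \<alpha> \<beta>" for \<alpha> \<beta> Y
  define J where "J \<alpha> \<beta> = (LINT t:{0<..}|lborel. gamma_kernel s t * D \<alpha> \<beta> (c * t))" for \<alpha> \<beta>
  have D_int: "set_integrable lborel {0<..} (\<lambda>t. gamma_kernel s t * D \<alpha> \<beta> (c * t))"
    and T_sum: "((\<lambda>(m, n). Gamma s * T (real n + \<beta>) (real m + \<alpha>)) has_sum J \<alpha> \<beta>) UNIV"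
    if "0 < \<alpha>" "\<alpha> < 1" "0 < \<beta>" "\<beta> < 1" for \<alpha> \<beta>
  proof -
    have "T u v = of_real (u ^ k) / of_real (c * (u * v) + 1) powr s" for u v
      by (simp add: T_def c_def s_def)
    thus "((\<lambda>(m, n). Gamma s * T (real n + \<beta>) (real m + \<alpha>)) has_sum J \<alpha> \<beta>) UNIV"
      using mellin_double_power_exp_sum(2)[OF c that \<nu>] unfolding J_def D_def s_def by simp
    show "set_integrable lborel {0<..} (\<lambda>t. gamma_kernel s t * D \<alpha> \<beta> (c * t))"
      unfolding D_def s_def by (rule mellin_double_power_exp_sum(1)[OF c that \<nu>])
  qed
  define J' where "J' = J \<theta> \<psi> - J \<theta> (1 - \<psi>) - J (1 - \<theta>) \<psi> + J (1 - \<theta>) (1 - \<psi>)"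
  \<comment> \<open>Differences are written as sums with negatives to fit \<open>has_sum_add\<close>
    and \<open>has_sum_uminusI\<close>.\<close>
  have "((\<lambda>i. (case i of (m, n) \<Rightarrow> Gamma s * T (real n + \<psi>) (real m + \<theta>))
     + - (case i of (m, n) \<Rightarrow> Gamma s * T (real n + (1 - \<psi>)) (real m + \<theta>))
     + - (case i of (m, n) \<Rightarrow> Gamma s * T (real n + \<psi>) (real m + (1 - \<theta>)))
     + (case i of (m, n) \<Rightarrow> Gamma s * T (real n + (1 - \<psi>)) (real m + (1 - \<theta>)))) has_sum J') UNIV"
    unfolding J'_def diff_conv_add_uminus[of "_ :: complex"] by (intro has_sum_add has_sum_uminusI T_sum \<theta> \<psi> \<theta>' \<psi>')
  also have "(\<lambda>i. (case i of (m, n) \<Rightarrow> Gamma s * T (real n + \<psi>) (real m + \<theta>))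
     + - (case i of (m, n) \<Rightarrow> Gamma s * T (real n + (1 - \<psi>)) (real m + \<theta>))
     + - (case i of (m, n) \<Rightarrow> Gamma s * T (real n + \<psi>) (real m + (1 - \<theta>)))
     + (case i of (m, n) \<Rightarrow> Gamma s * T (real n + (1 - \<psi>)) (real m + (1 - \<theta>)))) = (\<lambda>i. Gamma s * g i)"
    by (auto simp: g_def algebra_simps)
  finally have Gg: "((\<lambda>i. Gamma s * g i) has_sum J') UNIV" .
  have "((\<lambda>i. inverse (Gamma s) * (Gamma s * g i)) has_sum inverse (Gamma s) * J') UNIV"
    using Gg by (rule has_sum_cmult_right)
  hence g: "(g has_sum inverse (Gamma s) * J') UNIV"
    using \<Gamma> by (simp add: mult.assoc[symmetric])
  hence J'_eq: "J' = Gamma s * infsum g UNIV"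
    using \<Gamma> by (simp add: infsumI)
  define X where "X t = (\<Sum>j. complex_of_real (divisor_sine_sum k \<theta> \<psi> (Suc j) * exp (- (q / t * real (Suc j)))))" for t
  define B where "B = - 4 * (2 * pi * \<i> / c) ^ (k + 1)"
  have "J' = (LINT t:{0<..}|lborel. gamma_kernel s t * D \<theta> \<psi> (c * t) - gamma_kernel s t * D \<theta> (1 - \<psi>) (c * t)
      - gamma_kernel s t * D (1 - \<theta>) \<psi> (c * t) + gamma_kernel s t * D (1 - \<theta>) (1 - \<psi>) (c * t))"
    unfolding J'_def J_def
    by (simp only: set_integral_add set_integral_diff D_int \<theta> \<psi> \<theta>' \<psi>')
  also have "\<dots> = (LINT t:{0<..}|lborel. B * (gamma_kernel \<nu> t * X t))"
  proof (rule set_lebesgue_integral_cong, safe)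
    fix t :: real assume t: "t > 0"
    have ct: "c * t > 0" using c t by simp
    have y: "4 * pi\<^sup>2 / (c * t) = q / t" using cq by (simp add: divide_divide_eq_left[symmetric])
    have "D \<theta> \<psi> (c * t) - D \<theta> (1 - \<psi>) (c * t) - (D (1 - \<theta>) \<psi> (c * t) - D (1 - \<theta>) (1 - \<psi>) (c * t))
        = - 4 * (2 * pi * \<i> / of_real (c * t)) ^ (k + 1) * X t"
      unfolding D_def X_def using dual_sum_divisors[OF assms(8) ct \<theta> \<psi>] unfolding y .
    also have "(2 * pi * \<i> / of_real (c * t)) ^ (k + 1) = (2 * pi * \<i> / c) ^ (k + 1) / of_real (t ^ (k + 1))"
      by (simp add: power_divide power_mult_distrib)
    finally have D_eq: "D \<theta> \<psi> (c * t) - D \<theta> (1 - \<psi>) (c * t) - (D (1 - \<theta>) \<psi> (c * t) - D (1 - \<theta>) (1 - \<psi>) (c * t))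
        = B / of_real (t ^ (k + 1)) * X t" by (simp add: B_def)
    \<comment> \<open>The power t^(k+1) by which the kernels differ cancels the t-dependence of the
      weight factor (2 pi i / (c t))^(k+1).\<close>
    have "gamma_kernel s t = of_real (t ^ (k + 1)) * gamma_kernel \<nu> t"
      using gamma_kernel_shift[OF t, of \<nu> "k + 1"] by (simp add: s_def add_ac)
    moreover have "complex_of_real (t ^ (k + 1)) \<noteq> 0" using t by simp
    ultimately have "gamma_kernel s t * (B / of_real (t ^ (k + 1)) * X t) = B * (gamma_kernel \<nu> t * X t)"
      by (simp only:) (simp add: field_simps)
    thus "gamma_kernel s t * D \<theta> \<psi> (c * t) - gamma_kernel s t * D \<theta> (1 - \<psi>) (c * t)
      - gamma_kernel s t * D (1 - \<theta>) \<psi> (c * t) + gamma_kernel s t * D (1 - \<theta>) (1 - \<psi>) (c * t) = B * (gamma_kernel \<nu> t * X t)"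
      unfolding D_eq[symmetric] by (simp add: algebra_simps)
  qed simp
  also have "\<dots> = B * (LINT t:{0<..}|lborel. gamma_kernel \<nu> t * X t)"
    by (rule set_integral_mult_right)
  finally have J'_B: "J' = B * (LINT t:{0<..}|lborel. gamma_kernel \<nu> t * X t)" .
  \<comment> \<open>This is the value of i^(k+1) for odd k. As 2 pi / c = q / (2 pi), the weight
    factor is \<epsilon> times \<open>R\<close>, and \<epsilon>^2 = 1 lets the relation be solved
    for the Bessel integral.\<close>
  define \<epsilon> :: complex where "\<epsilon> = (-1) ^ ((k + 1) div 2)"
  have \<epsilon>2: "\<epsilon> * \<epsilon> = 1" by (simp add: \<epsilon>_def power_mult_distrib[symmetric])
  define R :: real where "R = (q / (2 * pi)) ^ (k + 1)"
  have B_eq: "B = - 4 * \<epsilon> * of_real R"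
  proof -
    have "2 * pi * \<i> / c = \<i> * of_real (q / (2 * pi))"
      using c by (simp add: cq[symmetric] field_simps power2_eq_square)
    hence "(2 * pi * \<i> / c) ^ (k + 1) = \<i> ^ (k + 1) * of_real R"
      by (simp only: power_mult_distrib R_def of_real_power)
    also have "\<i> ^ (k + 1) = \<i> ^ (2 * ((k + 1) div 2))" using assms(8) by simp
    also have "\<dots> = \<epsilon>" by (simp only: power_mult \<epsilon>_def power2_i)
    finally show ?thesis by (simp add: B_def)
  qed
  have R: "R > 0" using q by (simp add: R_def)
  have "(LINT t:{0<..}|lborel. gamma_kernel \<nu> t * X t) = - \<epsilon> / (4 * of_real R) * J'"
    using R \<epsilon>2 unfolding J'_B B_eq by (simp add: field_simps)
  with besselK_divisor_series[OF q \<nu>, of k \<theta> \<psi>]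
  have "(\<lambda>j. of_real (divisor_sine_sum k \<theta> \<psi> (Suc j)) * (2 * of_real (q * real (Suc j)) powr (\<nu> / 2) * besselK \<nu> (2 * sqrt (q * real (Suc j)))))
    sums (- \<epsilon> / (4 * of_real R) * (Gamma s * infsum g UNIV))"
    unfolding J'_eq X_def by simp
  \<comment> \<open>The 1/2 cancels the 2 in the Bessel integral, and q^(k+1) raises q^(\<nu>/2) to
    the prefactor of the theorem. On the right it meets \<open>R\<close> and leaves (2 pi)^(k+1) /
    8.\<close>
  from sums_mult[OF this, of "of_real (q ^ (k + 1) / 2)"]
  have S: "(\<lambda>j. of_real (q ^ (k + 1) / 2) * (of_real (divisor_sine_sum k \<theta> \<psi> (Suc j)) * (2 * of_real (q * real (Suc j)) powr (\<nu> / 2) * besselK \<nu> (2 * sqrt (q * real (Suc j))))))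
    sums (of_real (q ^ (k + 1) / 2) * (- \<epsilon> / (4 * of_real R) * (Gamma s * infsum g UNIV)))" .
  have lhs: "of_real (q ^ (k + 1) / 2) * (of_real (divisor_sine_sum k \<theta> \<psi> n) * (2 * of_real (q * real n) powr (\<nu> / 2) * besselK \<nu> (2 * sqrt (q * real n))))
      = of_real q powr (\<nu> / 2 + of_nat k + 1) * of_nat n powr (\<nu> / 2) * besselK \<nu> (a * sqrt (real n * x)) * of_real (divisor_sine_sum k \<theta> \<psi> n)" for n
  proof -
    have "2 * sqrt (q * real n) = a * sqrt (real n * x)"
      using assms(1) by (simp add: q_def real_sqrt_mult real_sqrt_divide mult_ac)
    moreover have "complex_of_real (q * real n) powr (\<nu> / 2) = of_real q powr (\<nu> / 2) * of_nat n powr (\<nu> / 2)"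
      using q by (simp add: powr_times_real)
    moreover have "of_real q powr (\<nu> / 2 + of_nat k + 1) = of_real q powr (\<nu> / 2) * complex_of_real (q ^ (k + 1))"
    proof -
      have "of_real q powr (\<nu> / 2 + of_nat k + 1) = of_real q powr (\<nu> / 2) * of_real q powr (of_nat (k + 1))"
        by (simp add: powr_add[symmetric] add_ac)
      also have "complex_of_real q powr (of_nat (k + 1)) = of_real (q ^ (k + 1))"
        using q by (subst powr_nat') auto
      finally show ?thesis .
    qed
    ultimately show ?thesis by (simp add: mult_ac)
  qed
  have rhs: "of_real (q ^ (k + 1) / 2) * (- \<epsilon> / (4 * of_real R) * (Gamma s * infsum g UNIV))
     = - (\<epsilon> / (8 * of_real ((2 * pi) powr (- real k - 1)))) * Gamma s * infsum g UNIV"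
  proof -
    have pow: "(2 * pi) powr (- real k - 1) = inverse ((2 * pi) ^ (k + 1))"
    proof -
      have "- real k - 1 = - real (k + 1)" by simp
      hence "(2 * pi) powr (- real k - 1) = (2 * pi) powr (- real (k + 1))" by (simp only:)
      also have "\<dots> = inverse ((2 * pi) ^ (k + 1))"
        unfolding powr_minus by (subst powr_realpow) auto
      finally show ?thesis .
    qed
    have R_quot: "R = q ^ (k + 1) / (2 * pi) ^ (k + 1)" by (simp add: R_def power_divide)
    have "Q / 2 / (4 * (Q / M)) = 1 / (8 * inverse M)" if "Q > 0" "M > 0" for Q M :: real
      using that by (simp add: divide_simps)
    from this[of "q ^ (k + 1)" "(2 * pi) ^ (k + 1)"] q
    have "q ^ (k + 1) / 2 / (4 * R) = 1 / (8 * (2 * pi) powr (- real k - 1))"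
      unfolding pow R_quot by (meson pi_gt_zero zero_less_mult_iff zero_less_numeral zero_less_power)
    hence "complex_of_real (q ^ (k + 1) / 2) / (4 * of_real R) = 1 / (8 * of_real ((2 * pi) powr (- real k - 1)))"
      unfolding of_real_eq_iff[where 'a = complex, symmetric]
      by (simp only: of_real_divide of_real_mult of_real_numeral of_real_1)
    hence "of_real (q ^ (k + 1) / 2) / (4 * of_real R) * (- \<epsilon> * (Gamma s * infsum g UNIV))
        = 1 / (8 * of_real ((2 * pi) powr (- real k - 1))) * (- \<epsilon> * (Gamma s * infsum g UNIV))"
      by (simp only:)
    thus ?thesis by (simp only: times_divide_eq_left times_divide_eq_right mult_1_left minus_divide_left mult_minus_left mult.assoc)
  qed
  have "g summable_on UNIV" using g by (auto simp: summable_on_def)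
  moreover have "(\<lambda>j. of_real q powr (\<nu> / 2 + of_nat k + 1) * of_nat (Suc j) powr (\<nu> / 2) * besselK \<nu> (a * sqrt (real (Suc j) * x)) * of_real (divisor_sine_sum k \<theta> \<psi> (Suc j)))
     sums (- (\<epsilon> / (8 * of_real ((2 * pi) powr (- real k - 1)))) * Gamma s * infsum g UNIV)"
    using S unfolding lhs rhs .
  ultimately show ?thesis
    unfolding Let_def q_def \<epsilon>_def s_def divisor_sine_sum_def by blast
qed

end
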